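(* Let $m$ be a positive integer with $m\equiv0$ mod $4$. There exist a (non-empty) almost Hermitian manifold $\mathcal{C}=(M,g,J)$ of real dimension $m$ and a smooth section $\Theta\in C^\infty\{\mathcal{U}_{\mathcal{C}}\}$ of the bundle of complex isometries of $TM$ such that, writing $\theta_P:=\Theta(P)$, for every point $P\in M$ we have: 1. $\theta_P\,\mathcal{J}_{\mathcal{C}}(\pi)=\mathcal{J}_{\mathcal{C}}(\theta_P\pi)\,\theta_P$ for all $\pi\in\mathbb{CP}(T_PM,J)$. 2. $\theta_P\,\mathcal{R}_{\mathcal{C}}(\pi)=\mathcal{R}_{\mathcal{C}}(\theta_P\pi)\,\theta_P$ for all $\pi\in\mathbb{CP}(T_PM,J)$. 3. $\theta_P^*R_P\neq R_P$.
   Context: An almost Hermitian manifold $(M,g,J)$ is a Riemannian manifold $(M,g)$ with an almost complex structure $J$ ($J^2=-\mathrm{id}$) that is unitary: $g(Jx,Jy)=g(x,y)$. $\mathcal{U}_{\mathcal{C}}$ is the bundle over $M$ whose fiber at $P$ is the unitary group of $(T_PM,g_P,J_P)$, i.e. the group of linear isometries of $(T_PM,g_P)$ commuting with $J_P$. Curvature operator: $\mathcal{R}(x,y)=\nabla_x\nabla_y-\nabla_y\nabla_x-\nabla_{[x,y]}$, with $\nabla$ the Levi-Civita connection; curvature tensor: $R(x,y,z,w)=g(\mathcal{R}(x,y)z,w)$. Jacobi operator: $\mathcal{J}(x)y=\mathcal{R}(y,x)x$. $\mathbb{CP}(T_PM,J)$ is the set of complex lines, i.e. real $2$-dimensional subspaces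 $\pi\subset T_PM$ with $J\pi=\pi$. For such $\pi$ and any unit vector $x\in\pi$, $\mathcal{J}_{\mathcal{C}}(\pi):=\mathcal{J}(x)+\mathcal{J}(Jx)$ and $\mathcal{R}_{\mathcal{C}}(\pi):=\mathcal{R}(x,Jx)$; these do not depend on the choice of the unit vector $x$. *)

theory Defs
  imports "HOL-Analysis.Analysis" "HOL-Library.Function_Algebras"
begin

text \<open>
  Tangent vectors will be functions on charts, so functions into a real vector space are
  made a real vector space with the pointwise operations.
\<close>

instantiation "fun" :: (type, real_vector) real_vector
begin

definition scaleR_fun :: "real \<Rightarrow> ('a \<Rightarrow> 'b) \<Rightarrow> 'a \<Rightarrow> 'b"
  where "scaleR_fun a f = (\<lambda>x. a *\<^sub>R f x)"

instance
  by standard (simp_all add: scaleR_fun_def plus_fun_def scaleR_add_right scaleR_add_left)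

end

text \<open>\<open>Ck_on\<close> is meant for open \<open>S\<close>, since the derivative is taken \<open>at x\<close> and not \<open>at x within S\<close>.\<close>

primrec Ck_on :: "nat \<Rightarrow> 'a set \<Rightarrow> ('a::euclidean_space \<Rightarrow> 'b::real_normed_vector) \<Rightarrow> bool" where
  "Ck_on 0 S f \<longleftrightarrow> continuous_on S f"
| "Ck_on (Suc k) S f \<longleftrightarrow> (\<forall>x\<in>S. f differentiable at x) \<and>
     (\<forall>v. Ck_on k S (\<lambda>x. frechet_derivative f (at x) v))"

definition smooth_on :: "'a set \<Rightarrow> ('a::euclidean_space \<Rightarrow> 'b::real_normed_vector) \<Rightarrow> bool"
  where "smooth_on S f \<longleftrightarrow> (\<forall>k. Ck_on k S f)"

text \<open>
  A chart \<open>(U, \<phi>)\<close> consists of its domain and its coordinate map, the values of \<open>\<phi>\<close> outside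
  \<open>U\<close> being irrelevant. The atlas need not be maximal; as usual it determines the smooth
  structure. Manifolds are Hausdorff and second countable; hence they have at most continuum
  many points, and choosing e.g. \<open>real ^ 'n\<close> for the type \<open>'p\<close> of points, with an
  arbitrary topology on a subset of it, loses no manifold up to diffeomorphism.
\<close>

type_synonym ('p, 'n) chart = "'p set \<times> ('p \<Rightarrow> real ^ 'n)"
type_synonym ('p, 'n) atlas = "('p, 'n) chart set"

abbreviation chart_dom :: "('p, 'n) chart \<Rightarrow> 'p set" where "chart_dom \<equiv> fst"
abbreviation chart_map :: "('p, 'n) chart \<Rightarrow> 'p \<Rightarrow> real ^ 'n" where "chart_map \<equiv> snd"

abbreviation chart_range :: "('p, 'n) chart \<Rightarrow> (real ^ 'n) set"
  where "chart_range c \<equiv> chart_map c ` chart_dom c"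

definition chart_inv :: "('p, 'n) chart \<Rightarrow> real ^ 'n \<Rightarrow> 'p"
  where "chart_inv c = inv_into (chart_dom c) (chart_map c)"

definition transition :: "('p, 'n) chart \<Rightarrow> ('p, 'n) chart \<Rightarrow> real ^ 'n \<Rightarrow> real ^ 'n"
  where "transition c d = chart_map d \<circ> chart_inv c"

definition points :: "('p, 'n) atlas \<Rightarrow> 'p set"
  where "points A = (\<Union>c\<in>A. chart_dom c)"

definition smooth_manifold :: "'p topology \<Rightarrow> ('p, 'n::finite) atlas \<Rightarrow> bool" where
  "smooth_manifold T A \<longleftrightarrow>
     Hausdorff_space T \<and> second_countable T \<and>
     points A = topspace T \<and>
     (\<forall>c\<in>A. openin T (chart_dom c) \<and> open (chart_range c) \<and>
        homeomorphic_map (subtopology T (chart_dom c)) (top_of_set (chart_range c)) (chart_map c)) \<and>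
     (\<forall>c\<in>A. \<forall>d\<in>A. smooth_on (chart_map c ` (chart_dom c \<inter> chart_dom d)) (transition c d))"

definition charts_at :: "('p, 'n) atlas \<Rightarrow> 'p \<Rightarrow> ('p, 'n) chart set"
  where "charts_at A P = {c \<in> A. P \<in> chart_dom c}"

definition smooth_fun :: "('p, 'n::finite) atlas \<Rightarrow> ('p \<Rightarrow> real) \<Rightarrow> bool"
  where "smooth_fun A f \<longleftrightarrow> (\<forall>c\<in>A. smooth_on (chart_range c) (f \<circ> chart_inv c))"

text \<open>
  A tangent vector at \<open>P\<close> is the family of its coordinate vectors in the charts around \<open>P\<close>,
  related by the differentials of the transition maps. The value \<open>0\<close> at all other charts
  makes the representation unique.
\<close>

type_synonym ('p, 'n) tvec = "('p, 'n) chart \<Rightarrow> real ^ 'n"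
type_synonym ('p, 'n) vfield = "'p \<Rightarrow> ('p, 'n) tvec"
type_synonym ('p, 'n) efield = "'p \<Rightarrow> ('p, 'n) tvec \<Rightarrow> ('p, 'n) tvec"
type_synonym ('p, 'n) bfield = "'p \<Rightarrow> ('p, 'n) tvec \<Rightarrow> ('p, 'n) tvec \<Rightarrow> real"
type_synonym ('p, 'n) connection = "('p, 'n) vfield \<Rightarrow> ('p, 'n) vfield \<Rightarrow> ('p, 'n) vfield"

definition tangent_space :: "('p, 'n::finite) atlas \<Rightarrow> 'p \<Rightarrow> ('p, 'n) tvec set" where
  "tangent_space A P =
     {v. (\<forall>c\<in>charts_at A P. \<forall>d\<in>charts_at A P.
            v d = frechet_derivative (transition c d) (at (chart_map c P)) (v c)) \<and>
         (\<forall>c. c \<notin> charts_at A P \<longrightarrow> v c = 0)}"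

text \<open>The tangent vector at \<open>P\<close> with coordinates \<open>u\<close> in the chart \<open>c\<close> around \<open>P\<close>:\<close>

definition coord_vec :: "('p, 'n::finite) atlas \<Rightarrow> ('p, 'n) chart \<Rightarrow> 'p \<Rightarrow> real ^ 'n \<Rightarrow> ('p, 'n) tvec" where
  "coord_vec A c P u = (\<lambda>d. if d \<in> charts_at A P
      then frechet_derivative (transition c d) (at (chart_map c P)) u else 0)"

definition smooth_vfield :: "('p, 'n::finite) atlas \<Rightarrow> ('p, 'n) vfield \<Rightarrow> bool" where
  "smooth_vfield A X \<longleftrightarrow>
     (\<forall>P\<in>points A. X P \<in> tangent_space A P) \<and>
     (\<forall>c\<in>A. smooth_on (chart_range c) (\<lambda>x. X (chart_inv c x) c))"

text \<open>Derivative of the function \<open>f\<close> at \<open>P\<close> in the direction of a tangent vector \<open>v\<close>;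
  by the chain rule any chart around \<open>P\<close> gives the same value.\<close>

definition dir_deriv :: "('p, 'n::finite) atlas \<Rightarrow> 'p \<Rightarrow> ('p, 'n) tvec \<Rightarrow> ('p \<Rightarrow> real) \<Rightarrow> real" where
  "dir_deriv A P v f = (let c = (SOME c. c \<in> charts_at A P) in
      frechet_derivative (f \<circ> chart_inv c) (at (chart_map c P)) (v c))"

text \<open>In every chart, \<open>[X,Y]\<^sup>i = X\<^sup>j \<partial>\<^sub>j Y\<^sup>i - Y\<^sup>j \<partial>\<^sub>j X\<^sup>i\<close>.\<close>

definition lie_bracket :: "('p, 'n::finite) atlas \<Rightarrow> ('p, 'n) vfield \<Rightarrow> ('p, 'n) vfield \<Rightarrow> ('p, 'n) vfield" where
  "lie_bracket A X Y = (\<lambda>P c. if c \<in> charts_at A P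
      then frechet_derivative (\<lambda>x. Y (chart_inv c x) c) (at (chart_map c P)) (X P c)
         - frechet_derivative (\<lambda>x. X (chart_inv c x) c) (at (chart_map c P)) (Y P c)
      else 0)"

definition linear_map_on :: "'a::real_vector set \<Rightarrow> ('a \<Rightarrow> 'b::real_vector) \<Rightarrow> bool" where
  "linear_map_on V f \<longleftrightarrow>
     (\<forall>x\<in>V. \<forall>y\<in>V. f (x + y) = f x + f y) \<and> (\<forall>a. \<forall>x\<in>V. f (a *\<^sub>R x) = a *\<^sub>R f x)"

definition riemannian_metric :: "('p, 'n::finite) atlas \<Rightarrow> ('p, 'n) bfield \<Rightarrow> bool" where
  "riemannian_metric A g \<longleftrightarrow>
     (\<forall>P\<in>points A. let V = tangent_space A P in
        (\<forall>x\<in>V. linear_map_on V (g P x)) \<and>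
        (\<forall>x\<in>V. \<forall>y\<in>V. g P x y = g P y x) \<and>
        (\<forall>x\<in>V. x \<noteq> 0 \<longrightarrow> g P x x > 0)) \<and>
     (\<forall>c\<in>A. \<forall>u w. smooth_on (chart_range c)
        (\<lambda>x. let P = chart_inv c x in g P (coord_vec A c P u) (coord_vec A c P w)))"

definition smooth_endomorphism_field :: "('p, 'n::finite) atlas \<Rightarrow> ('p, 'n) efield \<Rightarrow> bool" where
  "smooth_endomorphism_field A F \<longleftrightarrow>
     (\<forall>P\<in>points A. F P ` tangent_space A P \<subseteq> tangent_space A P \<and>
        linear_map_on (tangent_space A P) (F P)) \<and>
     (\<forall>c\<in>A. \<forall>u. smooth_on (chart_range c)
        (\<lambda>x. let P = chart_inv c x in F P (coord_vec A c P u) c))"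

definition almost_complex_structure :: "('p, 'n::finite) atlas \<Rightarrow> ('p, 'n) efield \<Rightarrow> bool" where
  "almost_complex_structure A J \<longleftrightarrow>
     smooth_endomorphism_field A J \<and>
     (\<forall>P\<in>points A. \<forall>x\<in>tangent_space A P. J P (J P x) = - x)"

definition almost_hermitian_manifold ::
    "'p topology \<Rightarrow> ('p, 'n::finite) atlas \<Rightarrow> ('p, 'n) bfield \<Rightarrow> ('p, 'n) efield \<Rightarrow> bool" where
  "almost_hermitian_manifold T A g J \<longleftrightarrow>
     smooth_manifold T A \<and> riemannian_metric A g \<and> almost_complex_structure A J \<and>
     (\<forall>P\<in>points A. \<forall>x\<in>tangent_space A P. \<forall>y\<in>tangent_space A P.
        g P (J P x) (J P y) = g P x y)"

text \<open>Smooth sections of the bundle of unitary groups. Bijectivity on the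
  finite-dimensional tangent spaces follows from isometry.\<close>

definition smooth_unitary_section ::
    "('p, 'n::finite) atlas \<Rightarrow> ('p, 'n) bfield \<Rightarrow> ('p, 'n) efield \<Rightarrow> ('p, 'n) efield \<Rightarrow> bool" where
  "smooth_unitary_section A g J \<Theta> \<longleftrightarrow>
     smooth_endomorphism_field A \<Theta> \<and>
     (\<forall>P\<in>points A. \<forall>x\<in>tangent_space A P.
        \<Theta> P (J P x) = J P (\<Theta> P x) \<and>
        (\<forall>y\<in>tangent_space A P. g P (\<Theta> P x) (\<Theta> P y) = g P x y))"

text \<open>By the Koszul formula these properties determine \<open>nabla X Y P\<close> for all smooth vector
  fields \<open>X\<close>, \<open>Y\<close> and all points \<open>P\<close>.\<close>

definition levi_civita :: "('p, 'n::finite) atlas \<Rightarrow> ('p, 'n) bfield \<Rightarrow> ('p, 'n) connection \<Rightarrow> bool" where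
  "levi_civita A g nabla \<longleftrightarrow>
     (\<forall>X Y. smooth_vfield A X \<longrightarrow> smooth_vfield A Y \<longrightarrow>
        smooth_vfield A (nabla X Y) \<and>
        (\<forall>Z. smooth_vfield A Z \<longrightarrow> (\<forall>P\<in>points A.
            nabla (X + Z) Y P = nabla X Y P + nabla Z Y P \<and>
            nabla X (Y + Z) P = nabla X Y P + nabla X Z P)) \<and>
        (\<forall>f. smooth_fun A f \<longrightarrow> (\<forall>P\<in>points A.
            nabla (\<lambda>Q. f Q *\<^sub>R X Q) Y P = f P *\<^sub>R nabla X Y P \<and>
            nabla X (\<lambda>Q. f Q *\<^sub>R Y Q) P = dir_deriv A P (X P) f *\<^sub>R Y P + f P *\<^sub>R nabla X Y P)) \<and>
        (\<forall>P\<in>points A. nabla X Y P - nabla Y X P = lie_bracket A X Y P) \<and>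
        (\<forall>Z. smooth_vfield A Z \<longrightarrow> (\<forall>P\<in>points A.
            dir_deriv A P (X P) (\<lambda>Q. g Q (Y Q) (Z Q)) =
              g P (nabla X Y P) (Z P) + g P (Y P) (nabla X Z P))))"

definition curvature_of_fields ::
    "('p, 'n::finite) atlas \<Rightarrow> ('p, 'n) connection \<Rightarrow>
     ('p, 'n) vfield \<Rightarrow> ('p, 'n) vfield \<Rightarrow> ('p, 'n) vfield \<Rightarrow> ('p, 'n) vfield" where
  "curvature_of_fields A nabla X Y Z = nabla X (nabla Y Z) - nabla Y (nabla X Z) - nabla (lie_bracket A X Y) Z"

definition extension :: "('p, 'n::finite) atlas \<Rightarrow> 'p \<Rightarrow> ('p, 'n) tvec \<Rightarrow> ('p, 'n) vfield"
  where "extension A P x = (SOME X. smooth_vfield A X \<and> X P = x)"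

text \<open>\<open>\<R>(x,y)z\<close> for tangent vectors at \<open>P\<close>; by tensoriality the choice of the
  smooth extensions is irrelevant.\<close>

definition curvature_operator ::
    "('p, 'n::finite) atlas \<Rightarrow> ('p, 'n) connection \<Rightarrow> 'p \<Rightarrow>
     ('p, 'n) tvec \<Rightarrow> ('p, 'n) tvec \<Rightarrow> ('p, 'n) tvec \<Rightarrow> ('p, 'n) tvec" where
  "curvature_operator A nabla P x y z =
     curvature_of_fields A nabla (extension A P x) (extension A P y) (extension A P z) P"

definition curvature_tensor ::
    "('p, 'n::finite) atlas \<Rightarrow> ('p, 'n) bfield \<Rightarrow> ('p, 'n) connection \<Rightarrow> 'p \<Rightarrow>
     ('p, 'n) tvec \<Rightarrow> ('p, 'n) tvec \<Rightarrow> ('p, 'n) tvec \<Rightarrow> ('p, 'n) tvec \<Rightarrow> real" where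
  "curvature_tensor A g nabla P x y z w = g P (curvature_operator A nabla P x y z) w"

definition pullback4 :: "('v \<Rightarrow> 'v) \<Rightarrow> ('v \<Rightarrow> 'v \<Rightarrow> 'v \<Rightarrow> 'v \<Rightarrow> real) \<Rightarrow> 'v \<Rightarrow> 'v \<Rightarrow> 'v \<Rightarrow> 'v \<Rightarrow> real"
  where "pullback4 \<theta> R x y z w = R (\<theta> x) (\<theta> y) (\<theta> z) (\<theta> w)"

definition jacobi_operator ::
    "('p, 'n::finite) atlas \<Rightarrow> ('p, 'n) connection \<Rightarrow> 'p \<Rightarrow> ('p, 'n) tvec \<Rightarrow> ('p, 'n) tvec \<Rightarrow> ('p, 'n) tvec" where
  "jacobi_operator A nabla P x y = curvature_operator A nabla P y x x"

definition complex_lines :: "('p, 'n::finite) atlas \<Rightarrow> ('p, 'n) efield \<Rightarrow> 'p \<Rightarrow> ('p, 'n) tvec set set" where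
  "complex_lines A J P =
     {\<pi>. \<pi> \<subseteq> tangent_space A P \<and> subspace \<pi> \<and> dim \<pi> = 2 \<and> J P ` \<pi> = \<pi>}"

definition unit_vector :: "('p, 'n) bfield \<Rightarrow> 'p \<Rightarrow> ('p, 'n) tvec set \<Rightarrow> ('p, 'n) tvec"
  where "unit_vector g P \<pi> = (SOME x. x \<in> \<pi> \<and> g P x x = 1)"

definition complex_jacobi_operator ::
    "('p, 'n::finite) atlas \<Rightarrow> ('p, 'n) bfield \<Rightarrow> ('p, 'n) efield \<Rightarrow> ('p, 'n) connection \<Rightarrow> 'p \<Rightarrow>
     ('p, 'n) tvec set \<Rightarrow> ('p, 'n) tvec \<Rightarrow> ('p, 'n) tvec" where
  "complex_jacobi_operator A g J nabla P \<pi> y =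
     (let x = unit_vector g P \<pi>
      in jacobi_operator A nabla P x y + jacobi_operator A nabla P (J P x) y)"

definition complex_curvature_operator ::
    "('p, 'n::finite) atlas \<Rightarrow> ('p, 'n) bfield \<Rightarrow> ('p, 'n) efield \<Rightarrow> ('p, 'n) connection \<Rightarrow> 'p \<Rightarrow>
     ('p, 'n) tvec set \<Rightarrow> ('p, 'n) tvec \<Rightarrow> ('p, 'n) tvec" where
  "complex_curvature_operator A g J nabla P \<pi> y =
     (let x = unit_vector g P \<pi> in curvature_operator A nabla P x (J P x) y)"

end

theory Submission
  imports Defs
begin

text \<open>
  Let \<open>M\<close> be the product of two hyperbolic planes \<open>dx\<^sub>a\<^sup>2 + exp (2x\<^sub>a) dx\<^sub>b\<^sup>2\<close> and
  \<open>dx\<^bsub>\<sigma>a\<^esub>\<^sup>2 + exp (2x\<^bsub>\<sigma>a\<^esub>) dx\<^bsub>\<sigma>b\<^esub>\<^sup>2\<close> and a flat factor, and let \<open>J\<close> interchange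
  the tangent planes of the two hyperbolic factors. Then \<open>R(Jx,Jy)Jz = J R(x,y)z\<close>, so that the
  curvature is a sum of components of weight \<open>0\<close> and \<open>4\<close> under the circle group
  \<open>cos t + sin t J\<close>, and the component of weight \<open>4\<close> does not vanish. The rotation
  \<open>\<theta> = 3/5 + 4/5 J\<close> preserves every complex line \<open>\<pi>\<close>. The operators \<open>\<J>\<^sub>\<C>(\<pi>)\<close> and
  \<open>\<R>\<^sub>\<C>(\<pi>)\<close> only involve the components of weight \<open>0\<close> and \<open>2\<close>, so they commute with \<open>J\<close>
  and with \<open>\<theta>\<close>, whereas \<open>\<theta>\<^sup>*R \<noteq> R\<close>.
\<close>

subsection \<open>Smooth maps\<close>

text \<open>Near a point of an open set the two functions agree, hence so do their derivatives
  there, and the induction continues with these derivatives.\<close>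

lemma Ck_on_cong:
  assumes "open S" "\<And>x. x \<in> S \<Longrightarrow> f x = g x"
  shows "Ck_on k S f \<longleftrightarrow> Ck_on k S g"
  using assms(2)
proof (induction k arbitrary: f g)
  case 0
  then show ?case by (auto cong: continuous_on_cong)
next
  case (Suc k)
  have diff: "f differentiable at x \<longleftrightarrow> g differentiable at x" if "x \<in> S" for x
    using Suc.prems that assms(1)
    by (metis (no_types, lifting) differentiable_def has_derivative_transform_within_open)
  have "Ck_on k S (\<lambda>x. frechet_derivative f (at x) v) \<longleftrightarrow>
        Ck_on k S (\<lambda>x. frechet_derivative g (at x) v)"
    if "\<forall>x\<in>S. f differentiable at x" for v
    using that Suc.prems assms(1)
    by (intro Suc.IH) (metis frechet_derivative_transform_within_open)
  then show ?case
    using diff by auto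
qed

lemma Ck_on_imp_continuous_on: "Ck_on k S f \<Longrightarrow> continuous_on S f"
  by (cases k)
    (auto intro!: continuous_at_imp_continuous_on differentiable_imp_continuous_within)

lemma Ck_on_SucD: "Ck_on (Suc k) S f \<Longrightarrow> Ck_on k S f"
proof (induction k arbitrary: f)
  case 0
  then show ?case using Ck_on_imp_continuous_on[of "Suc 0" S f] by simp
next
  case (Suc k)
  then show ?case by (metis Ck_on.simps(2))
qed

lemma smooth_on_imp_differentiable: "smooth_on S f \<Longrightarrow> x \<in> S \<Longrightarrow> f differentiable at x"
  unfolding smooth_on_def by (metis Ck_on.simps(2))

lemma smooth_on_imp_continuous_on: "smooth_on S f \<Longrightarrow> continuous_on S f"
  unfolding smooth_on_def by (meson Ck_on_imp_continuous_on)

lemma smooth_on_frechet_derivative: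
  "smooth_on S f \<Longrightarrow> smooth_on S (\<lambda>x. frechet_derivative f (at x) v)"
  unfolding smooth_on_def by (metis Ck_on.simps(2))

lemma smooth_on_cong:
  assumes "open S" "\<And>x. x \<in> S \<Longrightarrow> f x = g x"
  shows "smooth_on S f \<longleftrightarrow> smooth_on S g"
  unfolding smooth_on_def using Ck_on_cong[of S f g] assms by simp

lemma has_derivative_frechet: "f differentiable F \<Longrightarrow> (f has_derivative frechet_derivative f F) F"
  by (simp add: frechet_derivative_works)

lemma frechet_derivative_eqI: "(f has_derivative f') (at x) \<Longrightarrow> frechet_derivative f (at x) = f'"
  by (rule frechet_derivative_at[symmetric])

text \<open>Lets the inductions on the order below work with an explicit derivative formula
  \<open>f'\<close> instead of \<open>frechet_derivative\<close>.\<close>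

lemma Ck_on_SucI:
  assumes "open S" "\<And>x. x \<in> S \<Longrightarrow> (f has_derivative f' x) (at x)"
    and "\<And>v. Ck_on k S (\<lambda>x. f' x v)"
  shows "Ck_on (Suc k) S f"
proof -
  have "Ck_on k S (\<lambda>x. frechet_derivative f (at x) v)" for v
    using assms(3)[of v] by (subst Ck_on_cong[OF assms(1), where g = "\<lambda>x. f' x v"])
      (simp_all add: frechet_derivative_eqI[OF assms(2)])
  then show ?thesis
    using assms(2) by (auto simp: differentiable_def)
qed

lemma Ck_on_const: "Ck_on k S (\<lambda>x. c)"
  by (induction k arbitrary: c) auto

lemma smooth_on_const: "smooth_on S (\<lambda>x. c)"
  by (simp add: smooth_on_def Ck_on_const)

lemma smooth_on_bounded_linear_compose:
  assumes "open S" "bounded_linear L" "smooth_on S f"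
  shows "smooth_on S (\<lambda>x. L (f x))"
proof -
  have "Ck_on k S f \<Longrightarrow> Ck_on k S (\<lambda>x. L (f x))" for k
  proof (induction k arbitrary: f)
    case 0
    then show ?case by (auto intro: bounded_linear.continuous_on[OF assms(2)])
  next
    case (Suc k)
    then have d: "\<And>x. x \<in> S \<Longrightarrow>
        ((\<lambda>x. L (f x)) has_derivative (\<lambda>v. L (frechet_derivative f (at x) v))) (at x)"
      by (intro bounded_linear.has_derivative[OF assms(2)] has_derivative_frechet) auto
    show ?case using Suc by (intro Ck_on_SucI[OF assms(1) d]) auto
  qed
  then show ?thesis using assms(3) by (auto simp: smooth_on_def)
qed

lemma smooth_on_bounded_linear: "open S \<Longrightarrow> bounded_linear L \<Longrightarrow> smooth_on S L"
proof -
  assume *: "open S" "bounded_linear L"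
  have "Ck_on k S L" for k
  proof (cases k)
    case (Suc n)
    show ?thesis unfolding Suc
      by (rule Ck_on_SucI[OF *(1) bounded_linear_imp_has_derivative[OF *(2)]]) (rule Ck_on_const)
  qed (use *(2) in \<open>auto intro: linear_continuous_on\<close>)
  then show ?thesis by (simp add: smooth_on_def)
qed

lemma Ck_on_add:
  assumes "open S" "Ck_on k S f" "Ck_on k S g"
  shows "Ck_on k S (\<lambda>x. f x + g x)"
  using assms(2,3)
proof (induction k arbitrary: f g)
  case 0
  then show ?case by (auto intro: continuous_intros)
next
  case (Suc k)
  then have d: "\<And>x. x \<in> S \<Longrightarrow> ((\<lambda>x. f x + g x) has_derivative
      (\<lambda>v. frechet_derivative f (at x) v + frechet_derivative g (at x) v)) (at x)"
    by (auto intro!: has_derivative_add has_derivative_frechet)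
  show ?case using Suc by (intro Ck_on_SucI[OF assms(1) d]) auto
qed

lemma smooth_on_add:
  "open S \<Longrightarrow> smooth_on S f \<Longrightarrow> smooth_on S g \<Longrightarrow> smooth_on S (\<lambda>x. f x + g x)"
  unfolding smooth_on_def by (auto intro: Ck_on_add)

lemma smooth_on_sum:
  assumes "open S" "\<And>i. i \<in> I \<Longrightarrow> smooth_on S (f i)"
  shows "smooth_on S (\<lambda>x. \<Sum>i\<in>I. f i x)"
  using assms(2)
  by (induction I rule: infinite_finite_induct) (auto intro: smooth_on_const smooth_on_add[OF assms(1)])

lemma smooth_on_minus: "open S \<Longrightarrow> smooth_on S f \<Longrightarrow> smooth_on S (\<lambda>x. - f x)"
  by (rule smooth_on_bounded_linear_compose[OF _ bounded_linear_minus[OF bounded_linear_ident]])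

lemma smooth_on_diff:
  "open S \<Longrightarrow> smooth_on S f \<Longrightarrow> smooth_on S g \<Longrightarrow> smooth_on S (\<lambda>x. f x - g x)"
  using smooth_on_add[OF _ _ smooth_on_minus, of S f g] by simp

lemma Ck_on_scaleR:
  assumes "open S" "Ck_on k S a" "Ck_on k S f"
  shows "Ck_on k S (\<lambda>x. a x *\<^sub>R f x)"
  using assms(2,3)
proof (induction k arbitrary: a f)
  case 0
  then show ?case by (auto intro: continuous_intros)
next
  case (Suc k)
  then have d: "\<And>x. x \<in> S \<Longrightarrow> ((\<lambda>x. a x *\<^sub>R f x) has_derivative
      (\<lambda>v. a x *\<^sub>R frechet_derivative f (at x) v + frechet_derivative a (at x) v *\<^sub>R f x)) (at x)"
    by (auto intro!: has_derivative_scaleR has_derivative_frechet)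
  \<comment> \<open>The product rule pairs each derivative with an undifferentiated factor, whose
    order has to be lowered from \<open>Suc k\<close> to \<open>k\<close> before the induction
    hypothesis applies.\<close>
  show ?case using Suc Ck_on_SucD[OF Suc.prems(1)] Ck_on_SucD[OF Suc.prems(2)]
    by (intro Ck_on_SucI[OF assms(1) d] Ck_on_add[OF assms(1)]) auto
qed

lemma smooth_on_scaleR:
  "open S \<Longrightarrow> smooth_on S a \<Longrightarrow> smooth_on S f \<Longrightarrow> smooth_on S (\<lambda>x. a x *\<^sub>R f x)"
  unfolding smooth_on_def by (auto intro: Ck_on_scaleR)

lemma smooth_on_mult:
  "open S \<Longrightarrow> smooth_on S f \<Longrightarrow> smooth_on S g \<Longrightarrow> smooth_on S (\<lambda>x. f x * g x :: real)"
  using smooth_on_scaleR[of S f g] by simp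

text \<open>The derivative contains \<open>exp (f x)\<close> again, so the induction hypothesis for
  the same function supplies that factor at order \<open>k\<close>.\<close>

lemma smooth_on_exp:
  fixes f :: "'a::euclidean_space \<Rightarrow> real"
  assumes "open S" "smooth_on S f"
  shows "smooth_on S (\<lambda>x. exp (f x))"
proof -
  have d: "\<And>x. x \<in> S \<Longrightarrow> ((\<lambda>x. exp (f x)) has_derivative
      (\<lambda>v. exp (f x) *\<^sub>R frechet_derivative f (at x) v)) (at x)"
    by (auto intro!: derivative_eq_intros has_derivative_frechet
        smooth_on_imp_differentiable[OF assms(2)])
  have "Ck_on k S (\<lambda>x. exp (f x))" for k
  proof (induction k)
    case 0
    show ?case using smooth_on_imp_continuous_on[OF assms(2)] by (auto intro: continuous_intros)
  next
    case (Suc k)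
    show ?case
      using Suc smooth_on_frechet_derivative[OF assms(2)]
      by (intro Ck_on_SucI[OF assms(1) d] Ck_on_scaleR[OF assms(1)]) (auto simp: smooth_on_def)
  qed
  then show ?thesis by (simp add: smooth_on_def)
qed

lemma smooth_on_vec_nth:
  "open S \<Longrightarrow> smooth_on S f \<Longrightarrow> smooth_on S (\<lambda>x. f x $ i)"
  by (rule smooth_on_bounded_linear_compose[OF _ bounded_linear_vec_nth])

lemma smooth_on_vec_lambda:
  fixes f :: "'n::finite \<Rightarrow> 'a::euclidean_space \<Rightarrow> real"
  assumes "open S" "\<And>i. smooth_on S (f i)"
  shows "smooth_on S (\<lambda>x. \<chi> i. f i x)"
proof -
  have "(\<lambda>x. \<chi> i. f i x) = (\<lambda>x. \<Sum>i\<in>UNIV. f i x *\<^sub>R axis i 1)"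
    by (auto simp: vec_eq_iff axis_def if_distrib cong: if_cong)
  then show ?thesis
    using assms by (auto intro!: smooth_on_sum smooth_on_scaleR smooth_on_const)
qed

text \<open>In this expansion the direction enters only through scalar coefficients, so directions
  that vary with the base point can be handled by sums and products.\<close>

lemma frechet_derivative_sum_axis:
  fixes f :: "real ^ 'n::finite \<Rightarrow> 'b::real_normed_vector"
  assumes "f differentiable at x"
  shows "frechet_derivative f (at x) v = (\<Sum>i\<in>UNIV. v $ i *\<^sub>R frechet_derivative f (at x) (axis i 1))"
proof -
  interpret linear "frechet_derivative f (at x)"
    by (rule linear_frechet_derivative[OF assms])
  have "v = (\<Sum>i\<in>UNIV. v $ i *\<^sub>R axis i 1)"
    by (auto simp: vec_eq_iff axis_def if_distrib cong: if_cong)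
  then have "frechet_derivative f (at x) v = frechet_derivative f (at x) (\<Sum>i\<in>UNIV. v $ i *\<^sub>R axis i 1)"
    by simp
  then show ?thesis by (simp add: sum scale)
qed

lemma smooth_on_frechet_derivative_field:
  fixes f :: "real ^ 'n::finite \<Rightarrow> 'b::real_normed_vector"
  assumes S: "open S" and f: "smooth_on S f" and X: "smooth_on S X"
  shows "smooth_on S (\<lambda>x. frechet_derivative f (at x) (X x))"
proof -
  have "smooth_on S (\<lambda>x. \<Sum>i\<in>UNIV. X x $ i *\<^sub>R frechet_derivative f (at x) (axis i 1))"
    by (intro smooth_on_sum[OF S] smooth_on_scaleR[OF S] smooth_on_vec_nth[OF S X]
        smooth_on_frechet_derivative[OF f])
  then show ?thesis
    by (rule iffD2[OF smooth_on_cong[OF S], rotated])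
      (rule frechet_derivative_sum_axis[OF smooth_on_imp_differentiable[OF f]])
qed

text \<open>Product rule for the pairing of the differential of \<open>f\<close> with a field
  \<open>X\<close>: one term differentiates the differential with \<open>X\<close> frozen at
  \<open>x\<close>, the other differentiates \<open>X\<close>. It is needed for iterated covariant
  derivatives.\<close>

lemma has_derivative_frechet_derivative_field:
  fixes f :: "real ^ 'n::finite \<Rightarrow> 'b::real_normed_vector"
  assumes S: "open S" "x \<in> S" and f: "smooth_on S f" and X: "X differentiable at x"
  shows "((\<lambda>q. frechet_derivative f (at q) (X q)) has_derivative
    (\<lambda>h. frechet_derivative (\<lambda>q. frechet_derivative f (at q) (X x)) (at x) h
       + frechet_derivative f (at x) (frechet_derivative X (at x) h))) (at x)"
proof -
  note fd = smooth_on_imp_differentiable[OF f]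
  have f2: "((\<lambda>q. frechet_derivative f (at q) v) has_derivative
      frechet_derivative (\<lambda>q. frechet_derivative f (at q) v) (at x)) (at x)" for v
    by (intro has_derivative_frechet smooth_on_imp_differentiable[OF smooth_on_frechet_derivative[OF f]] S)
  let ?A = "\<lambda>h i. frechet_derivative (\<lambda>q. frechet_derivative f (at q) (axis i 1)) (at x) h"
  have "((\<lambda>q. \<Sum>i\<in>UNIV. X x $ i *\<^sub>R frechet_derivative f (at q) (axis i 1)) has_derivative
      (\<lambda>h. \<Sum>i\<in>UNIV. X x $ i *\<^sub>R ?A h i)) (at x)"
    by (auto intro!: derivative_eq_intros f2)
  then have "((\<lambda>q. frechet_derivative f (at q) (X x)) has_derivative
      (\<lambda>h. \<Sum>i\<in>UNIV. X x $ i *\<^sub>R ?A h i)) (at x)"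
    by (rule has_derivative_transform_within_open[OF _ S])
      (rule frechet_derivative_sum_axis[OF fd, symmetric])
  then have A: "frechet_derivative (\<lambda>q. frechet_derivative f (at q) (X x)) (at x) h
      = (\<Sum>i\<in>UNIV. X x $ i *\<^sub>R ?A h i)" for h
    by (simp add: frechet_derivative_eqI)
  have "((\<lambda>q. \<Sum>i\<in>UNIV. X q $ i *\<^sub>R frechet_derivative f (at q) (axis i 1)) has_derivative
      (\<lambda>h. \<Sum>i\<in>UNIV. X x $ i *\<^sub>R ?A h i
        + frechet_derivative X (at x) h $ i *\<^sub>R frechet_derivative f (at x) (axis i 1))) (at x)"
    by (intro has_derivative_sum has_derivative_scaleR f2
        bounded_linear.has_derivative[OF bounded_linear_vec_nth] has_derivative_frechet X)
  then have "((\<lambda>q. frechet_derivative f (at q) (X q)) has_derivative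
      (\<lambda>h. \<Sum>i\<in>UNIV. X x $ i *\<^sub>R ?A h i
        + frechet_derivative X (at x) h $ i *\<^sub>R frechet_derivative f (at x) (axis i 1))) (at x)"
    by (rule has_derivative_transform_within_open[OF _ S])
      (rule frechet_derivative_sum_axis[OF fd, symmetric])
  then show ?thesis
    unfolding A sum.distrib frechet_derivative_sum_axis[OF fd[OF S(2)], symmetric] .
qed

section \<open>Symmetry of second derivatives\<close>

lemma second_difference:
  fixes f :: "'a::euclidean_space \<Rightarrow> real"
  assumes "0 < h" and S: "\<And>s t. s \<in> {0..h} \<Longrightarrow> t \<in> {0..h} \<Longrightarrow> p + s *\<^sub>R u + t *\<^sub>R v \<in> S"
    and f: "\<And>x. x \<in> S \<Longrightarrow> f differentiable at x"
    and f': "\<And>x. x \<in> S \<Longrightarrow> (\<lambda>x. frechet_derivative f (at x) u) differentiable at x"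
  obtains s t where "s \<in> {0..h}" "t \<in> {0..h}"
    "f (p + h *\<^sub>R u + h *\<^sub>R v) - f (p + h *\<^sub>R u) - f (p + h *\<^sub>R v) + f p =
       h * h * frechet_derivative (\<lambda>x. frechet_derivative f (at x) u) (at (p + s *\<^sub>R u + t *\<^sub>R v)) v"
proof -
  let ?F = "\<lambda>x. frechet_derivative f (at x) u"
  \<comment> \<open>Restriction to an affine line brings the one-variable mean value theorem into
    play.\<close>
  have line: "((\<lambda>s. g (q + s *\<^sub>R w)) has_field_derivative frechet_derivative g (at (q + s *\<^sub>R w)) w) (at s)"
    if "g differentiable at (q + s *\<^sub>R w)" for g :: "'a \<Rightarrow> real" and q w s
  proof -
    have "((\<lambda>s. g (q + s *\<^sub>R w)) has_derivative (\<lambda>r. frechet_derivative g (at (q + s *\<^sub>R w)) (r *\<^sub>R w))) (at s)"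
    proof (rule has_derivative_compose[of "\<lambda>s. q + s *\<^sub>R w" _ _ _ g])
      show "((\<lambda>s. q + s *\<^sub>R w) has_derivative (\<lambda>r. r *\<^sub>R w)) (at s)"
        by (auto intro!: derivative_eq_intros)
    qed (rule has_derivative_frechet[OF that])
    also have "(\<lambda>r. frechet_derivative g (at (q + s *\<^sub>R w)) (r *\<^sub>R w)) =
        (*) (frechet_derivative g (at (q + s *\<^sub>R w)) w)"
      by (simp add: fun_eq_iff linear_cmul[OF linear_frechet_derivative[OF that]])
    finally show ?thesis by (simp only: has_field_derivative_def)
  qed
  \<comment> \<open>The second difference is the increment of \<open>?G\<close> over the interval
    from 0 to \<open>h\<close>. The mean value theorem turns it into a first difference of the
    \<open>u\<close>-derivative, and a second application, along \<open>v\<close>, finishes.\<close>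
  let ?G = "\<lambda>s. f ((p + h *\<^sub>R v) + s *\<^sub>R u) - f (p + s *\<^sub>R u)"
  have "(?G has_field_derivative (?F ((p + h *\<^sub>R v) + s *\<^sub>R u) - ?F (p + s *\<^sub>R u))) (at s)"
    if "0 \<le> s" "s \<le> h" for s
    using S[of s h] S[of s 0] that \<open>0 < h\<close>
    by (intro DERIV_diff line f) (auto simp: algebra_simps)
  from MVT2[OF \<open>0 < h\<close> this] obtain s where s: "0 < s" "s < h"
    "?G h - ?G 0 = h * (?F ((p + h *\<^sub>R v) + s *\<^sub>R u) - ?F (p + s *\<^sub>R u))" by auto
  have "((\<lambda>t. ?F ((p + s *\<^sub>R u) + t *\<^sub>R v)) has_field_derivative
      frechet_derivative ?F (at ((p + s *\<^sub>R u) + t *\<^sub>R v)) v) (at t)"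
    if "0 \<le> t" "t \<le> h" for t
    using S[of s t] that s by (intro line f') auto
  from MVT2[OF \<open>0 < h\<close> this] obtain t where t: "0 < t" "t < h"
    "?F ((p + s *\<^sub>R u) + h *\<^sub>R v) - ?F (p + s *\<^sub>R u)
      = h * frechet_derivative ?F (at ((p + s *\<^sub>R u) + t *\<^sub>R v)) v" by auto
  show ?thesis
    using s t by (intro that[of s t]) (auto simp: algebra_simps)
qed

text \<open>The second difference over a parallelogram is symmetric in \<open>u\<close> and
  \<open>v\<close>, so the two mixed derivatives agree at two points near \<open>p\<close>.
  Continuity carries the equality to \<open>p\<close> as the parallelogram shrinks.\<close>

lemma frechet_derivative_commute_real:
  fixes f :: "'a::euclidean_space \<Rightarrow> real"
  assumes "open S" "p \<in> S" and f: "Ck_on 2 S f"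
  shows "frechet_derivative (\<lambda>x. frechet_derivative f (at x) u) (at p) v =
         frechet_derivative (\<lambda>x. frechet_derivative f (at x) v) (at p) u"
proof -
  let ?D = "\<lambda>u v q. frechet_derivative (\<lambda>x. frechet_derivative f (at x) u) (at q) v"
  have C: "continuous_on S (?D u v)" and f1: "\<And>x. x \<in> S \<Longrightarrow> f differentiable at x"
    and f2: "\<And>x. x \<in> S \<Longrightarrow> (\<lambda>x. frechet_derivative f (at x) u) differentiable at x" for u v
    using f by (auto simp: numeral_2_eq_2)
  have close: "\<exists>d>0. \<forall>q\<in>ball p d. \<bar>?D u v q - ?D u v p\<bar> < e" if "e > 0" for e u v
  proof -
    have "isCont (?D u v) p"
      using C assms(1,2) by (simp add: continuous_on_eq_continuous_at)
    then obtain d where "d > 0" "\<forall>q. dist q p < d \<longrightarrow> dist (?D u v q) (?D u v p) < e"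
      using \<open>e > 0\<close> unfolding continuous_at_eps_delta by blast
    then show ?thesis by (intro exI[of _ d]) (auto simp: dist_commute dist_real_def)
  qed
  have "\<bar>?D u v p - ?D v u p\<bar> \<le> e" if e: "e > 0" for e
  proof -
    obtain d1 where d1: "d1 > 0" "\<And>q. q \<in> ball p d1 \<Longrightarrow> \<bar>?D u v q - ?D u v p\<bar> < e / 2"
      using close[of "e / 2" u v] e by auto
    obtain d2 where d2: "d2 > 0" "\<And>q. q \<in> ball p d2 \<Longrightarrow> \<bar>?D v u q - ?D v u p\<bar> < e / 2"
      using close[of "e / 2" v u] e by auto
    obtain d3 where d3: "d3 > 0" "ball p d3 \<subseteq> S"
      using assms(1,2) open_contains_ball by blast
    define d where "d = min d1 (min d2 d3)"
    have d: "d > 0" "d \<le> d1" "d \<le> d2" "d \<le> d3"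
      using d1 d2 d3 by (auto simp: d_def)
    \<comment> \<open>This size keeps the whole parallelogram in \<open>ball p d\<close>; the
      summand 1 keeps the denominator positive when \<open>u\<close> and \<open>v\<close> both
      vanish.\<close>
    define h where "h = d / (norm u + norm v + 1)"
    have n: "norm u + norm v + 1 > 0"
      using norm_ge_zero[of u] norm_ge_zero[of v] by linarith
    have h: "h > 0" using d n by (simp add: h_def)
    have hd: "h * norm u + h * norm v < d"
    proof -
      have "h * (norm u + norm v + 1) = d" using n by (simp add: h_def)
      then show ?thesis using h by (simp add: algebra_simps)
    qed
    have dist_add: "dist p (p + x) = norm x" for x
      by (simp add: dist_norm)
    have ball: "p + s *\<^sub>R u + t *\<^sub>R v \<in> ball p d" if "s \<in> {0..h}" "t \<in> {0..h}" for s t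
    proof -
      have "norm (s *\<^sub>R u + t *\<^sub>R v) \<le> s * norm u + t * norm v"
        using that norm_triangle_ineq[of "s *\<^sub>R u" "t *\<^sub>R v"] by simp
      also have "\<dots> \<le> h * norm u + h * norm v"
        using that by (intro add_mono mult_right_mono) auto
      also have "\<dots> < d" by (rule hd)
      finally show ?thesis
        using dist_add[of "s *\<^sub>R u + t *\<^sub>R v"] by (simp add: add.assoc)
    qed
    then have ball': "p + t *\<^sub>R v + s *\<^sub>R u \<in> ball p d" if "s \<in> {0..h}" "t \<in> {0..h}" for s t
      using that by (simp add: add.assoc add.commute[of "t *\<^sub>R v"])
    have inS: "p + s *\<^sub>R u + t *\<^sub>R v \<in> S" and inS': "p + s *\<^sub>R v + t *\<^sub>R u \<in> S"
      if "s \<in> {0..h}" "t \<in> {0..h}" for s t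
      using ball[OF that] ball'[OF that(2,1)] d(4) d3(2) by auto
    obtain s t where st: "s \<in> {0..h}" "t \<in> {0..h}"
      "f (p + h *\<^sub>R u + h *\<^sub>R v) - f (p + h *\<^sub>R u) - f (p + h *\<^sub>R v) + f p
        = h * h * ?D u v (p + s *\<^sub>R u + t *\<^sub>R v)"
      by (rule second_difference[OF h inS f1 f2])
    obtain s' t' where st': "s' \<in> {0..h}" "t' \<in> {0..h}"
      "f (p + h *\<^sub>R v + h *\<^sub>R u) - f (p + h *\<^sub>R v) - f (p + h *\<^sub>R u) + f p
        = h * h * ?D v u (p + s' *\<^sub>R v + t' *\<^sub>R u)"
      by (rule second_difference[OF h inS' f1 f2])
    have swap: "p + h *\<^sub>R v + h *\<^sub>R u = p + h *\<^sub>R u + h *\<^sub>R v"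
      by (simp add: algebra_simps)
    have "h * h * ?D u v (p + s *\<^sub>R u + t *\<^sub>R v) = h * h * ?D v u (p + s' *\<^sub>R v + t' *\<^sub>R u)"
      using st(3) st'(3) unfolding swap by linarith
    then have "?D u v (p + s *\<^sub>R u + t *\<^sub>R v) = ?D v u (p + s' *\<^sub>R v + t' *\<^sub>R u)"
      using h by simp
    moreover have "\<bar>?D u v (p + s *\<^sub>R u + t *\<^sub>R v) - ?D u v p\<bar> < e / 2"
      using d1(2) ball[OF st(1,2)] d by auto
    moreover have "\<bar>?D v u (p + s' *\<^sub>R v + t' *\<^sub>R u) - ?D v u p\<bar> < e / 2"
      using d2(2) ball'[OF st'(2,1)] d by auto
    ultimately show ?thesis by linarith
  qed
  then show ?thesis
    using dense_ge[of 0 "\<bar>?D u v p - ?D v u p\<bar>"] by auto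
qed

text \<open>Taking a coordinate is linear and passes through both derivatives, which reduces the
  claim to real-valued functions.\<close>

lemma frechet_derivative_commute:
  fixes f :: "'a::euclidean_space \<Rightarrow> real ^ 'n::finite"
  assumes "open S" "p \<in> S" and f: "smooth_on S f"
  shows "frechet_derivative (\<lambda>x. frechet_derivative f (at x) u) (at p) v =
         frechet_derivative (\<lambda>x. frechet_derivative f (at x) v) (at p) u"
proof -
  have nth: "frechet_derivative (\<lambda>x. g x $ i) (at x) u = frechet_derivative g (at x) u $ i"
    if "g differentiable at x" for g :: "'a \<Rightarrow> real ^ 'n" and x u i
    by (simp add: frechet_derivative_eqI[OF bounded_linear.has_derivative[OF
          bounded_linear_vec_nth has_derivative_frechet[OF that]]])
  have D: "frechet_derivative (\<lambda>x. frechet_derivative f (at x) u) (at p) v $ i =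
      frechet_derivative (\<lambda>x. frechet_derivative (\<lambda>x. f x $ i) (at x) u) (at p) v" for u v i
  proof -
    have df: "(\<lambda>x. frechet_derivative f (at x) u) differentiable at p"
      by (intro smooth_on_imp_differentiable[OF smooth_on_frechet_derivative[OF f]] assms)
    have "frechet_derivative (\<lambda>x. frechet_derivative f (at x) u $ i) (at p) v =
      frechet_derivative (\<lambda>x. frechet_derivative (\<lambda>x. f x $ i) (at x) u) (at p) v"
      by (rule fun_cong[OF frechet_derivative_transform_within_open[OF _ assms(1,2)]])
        (auto simp: nth smooth_on_imp_differentiable[OF f] intro: bounded_linear_imp_differentiable
          differentiable_compose[OF bounded_linear_imp_differentiable[OF bounded_linear_vec_nth] df])
    then show ?thesis by (simp add: nth[OF df])
  qed
  have "Ck_on 2 S (\<lambda>x. f x $ i)" for i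
    using smooth_on_vec_nth[OF assms(1) f] by (auto simp: smooth_on_def)
  then show ?thesis
    using frechet_derivative_commute_real[OF assms(1,2)] by (simp add: vec_eq_iff D)
qed

subsection \<open>Manifolds with a single global chart\<close>

lemma second_countable_euclidean:
  "second_countable (euclidean :: 'a::second_countable_topology topology)"
proof -
  obtain B :: "'a set set" where "countable B" "topological_basis B"
    using ex_countable_basis by blast
  then show ?thesis
    unfolding second_countable_def
    by (intro exI[of _ B]) (simp add: topological_basis_open, metis topological_basisE)
qed

definition std_chart :: "(real ^ 'n, 'n) chart"
  where "std_chart = (UNIV, id)"

text \<open>The value 0 away from \<open>std_chart\<close> is the normalisation built into
  \<open>tangent_space\<close>, so that \<open>tvec\<close> parametrises every tangent
  space.\<close>

definition tvec :: "real ^ 'n \<Rightarrow> (real ^ 'n, 'n) tvec"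
  where "tvec u = (\<lambda>c. if c = std_chart then u else 0)"

abbreviation std_atlas :: "(real ^ 'n, 'n) atlas"
  where "std_atlas \<equiv> {std_chart}"

lemma tvec_std_chart [simp]: "tvec u std_chart = u"
  by (simp add: tvec_def)

lemma tvec_add: "tvec (u + v) = tvec u + tvec v"
  and tvec_scaleR: "tvec (r *\<^sub>R u) = r *\<^sub>R tvec u"
  and tvec_minus: "tvec (- u) = - tvec u"
  and tvec_diff: "tvec (u - v) = tvec u - tvec v"
  and tvec_0: "tvec 0 = 0"
  by (auto simp: tvec_def fun_eq_iff scaleR_fun_def)

lemma tvec_eq_iff [simp]: "tvec u = tvec v \<longleftrightarrow> u = v"
  by (metis tvec_std_chart)

lemma scaleR_fun_apply [simp]: "(r *\<^sub>R f) c = r *\<^sub>R f c"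
  by (simp add: scaleR_fun_def)

lemma std_chart_simps [simp]:
  "chart_dom std_chart = UNIV" "chart_map std_chart = id" "chart_inv std_chart = id"
  "transition std_chart std_chart = id"
proof -
  show "chart_inv std_chart = id"
    by (simp add: std_chart_def chart_inv_def fun_eq_iff)
  then show "transition std_chart std_chart = id"
    by (simp add: transition_def std_chart_def)
qed (simp_all add: std_chart_def)

lemma charts_at_std [simp]: "charts_at std_atlas P = std_atlas"
  by (auto simp: charts_at_def)

lemma points_std [simp]: "points std_atlas = UNIV"
  by (simp add: points_def)

lemma tangent_space_std: "tangent_space std_atlas P = range tvec"
  by (auto simp: tangent_space_def tvec_def fun_eq_iff image_iff)

lemma tvec_in_tangent_space [simp]: "tvec u \<in> tangent_space std_atlas P"
  by (simp add: tangent_space_std)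

lemma tangent_space_stdE:
  assumes "x \<in> tangent_space std_atlas P"
  obtains u where "x = tvec u"
  using assms by (auto simp: tangent_space_std)

lemma coord_vec_std [simp]: "coord_vec std_atlas std_chart P u = tvec u"
  by (simp add: coord_vec_def tvec_def fun_eq_iff)

lemma smooth_manifold_std: "smooth_manifold euclidean std_atlas"
  using smooth_on_bounded_linear[OF open_UNIV bounded_linear_ident, folded id_def]
  by (simp add: smooth_manifold_def second_countable_euclidean)

lemma smooth_fun_std: "smooth_fun std_atlas f \<longleftrightarrow> smooth_on UNIV f"
  by (simp add: smooth_fun_def)

lemma smooth_vfield_std:
  "smooth_vfield std_atlas X \<longleftrightarrow>
    (\<forall>P. X P = tvec (X P std_chart)) \<and> smooth_on UNIV (\<lambda>P. X P std_chart)"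
  by (simp add: smooth_vfield_def tangent_space_std image_iff) (metis tvec_std_chart)

lemma smooth_vfield_tvec: "smooth_vfield std_atlas (\<lambda>P. tvec (x P)) \<longleftrightarrow> smooth_on UNIV x"
  by (simp add: smooth_vfield_std)

lemma smooth_vfield_stdE:
  assumes "smooth_vfield std_atlas X"
  obtains x where "X = (\<lambda>P. tvec (x P))" "smooth_on UNIV x"
  using assms that[of "\<lambda>P. X P std_chart"] by (auto simp: smooth_vfield_std)

lemma dir_deriv_std [simp]:
  "dir_deriv std_atlas P v f = frechet_derivative f (at P) (v std_chart)"
  by (simp add: dir_deriv_def)

lemma lie_bracket_tvec:
  "lie_bracket std_atlas (\<lambda>P. tvec (x P)) (\<lambda>P. tvec (y P)) =
    (\<lambda>P. tvec (frechet_derivative y (at P) (x P) - frechet_derivative x (at P) (y P)))"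
  by (auto simp: lie_bracket_def tvec_def fun_eq_iff)

text \<open>A constant field shows that the choice in \<open>extension\<close> is from a non-empty
  set. Later arguments use only smoothness and the value at \<open>P\<close>.\<close>

lemma extension_stdE:
  obtains x where "extension std_atlas P (tvec u) = (\<lambda>Q. tvec (x Q))" "smooth_on UNIV x" "x P = u"
proof -
  have "smooth_vfield std_atlas (\<lambda>_. tvec u)"
    by (simp add: smooth_vfield_tvec smooth_on_const)
  then have "smooth_vfield std_atlas (extension std_atlas P (tvec u)) \<and>
      extension std_atlas P (tvec u) P = tvec u"
    unfolding extension_def
    by (intro someI[of "\<lambda>X. smooth_vfield std_atlas X \<and> X P = tvec u" "\<lambda>_. tvec u"]) simp
  then show ?thesis
    by (elim conjE smooth_vfield_stdE) (auto intro: that)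
qed

lemma smooth_endomorphism_field_tvec:
  "smooth_endomorphism_field std_atlas (\<lambda>P x. tvec (F P (x std_chart))) \<longleftrightarrow>
    (\<forall>P. linear (F P)) \<and> (\<forall>u. smooth_on UNIV (\<lambda>P. F P u))"
  by (simp add: smooth_endomorphism_field_def linear_map_on_def linear_iff tangent_space_std
      image_subset_iff flip: tvec_add tvec_scaleR)

lemma riemannian_metric_std:
  "riemannian_metric std_atlas (\<lambda>P x y. G P (x std_chart) (y std_chart)) \<longleftrightarrow>
    (\<forall>P. (\<forall>u. linear (G P u)) \<and> (\<forall>u v. G P u v = G P v u) \<and> (\<forall>u. u \<noteq> 0 \<longrightarrow> G P u u > 0)) \<and>
    (\<forall>u v. smooth_on UNIV (\<lambda>P. G P u v))"
  by (simp add: riemannian_metric_def linear_map_on_def linear_iff tangent_space_std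
      flip: tvec_add tvec_scaleR tvec_0)

section \<open>Connections given by Christoffel symbols, and their curvature\<close>

definition christoffel_connection ::
    "(real ^ 'n \<Rightarrow> real ^ 'n \<Rightarrow> real ^ 'n \<Rightarrow> real ^ 'n) \<Rightarrow> (real ^ 'n, 'n) connection" where
  "christoffel_connection \<Gamma> X Y = (\<lambda>P. tvec
     (frechet_derivative (\<lambda>Q. Y Q std_chart) (at P) (X P std_chart) + \<Gamma> P (X P std_chart) (Y P std_chart)))"

text \<open>\<open>\<Gamma>'\<close> is the derivative of \<open>\<Gamma>\<close> in its base point, in the direction of the argument after it.\<close>

locale christoffel =
  fixes \<Gamma> :: "real ^ 'n \<Rightarrow> real ^ 'n \<Rightarrow> real ^ 'n \<Rightarrow> real ^ 'n::finite"
    and \<Gamma>' :: "real ^ 'n \<Rightarrow> real ^ 'n \<Rightarrow> real ^ 'n \<Rightarrow> real ^ 'n \<Rightarrow> real ^ 'n"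
  assumes linear: "linear (\<Gamma> P u)"
    and sym: "\<Gamma> P u v = \<Gamma> P v u"
    and smooth: "smooth_on UNIV y \<Longrightarrow> smooth_on UNIV z \<Longrightarrow> smooth_on UNIV (\<lambda>Q. \<Gamma> Q (y Q) (z Q))"
    and deriv: "(y has_derivative y') (at P) \<Longrightarrow> (z has_derivative z') (at P) \<Longrightarrow>
      ((\<lambda>Q. \<Gamma> Q (y Q) (z Q)) has_derivative
        (\<lambda>h. \<Gamma>' P h (y P) (z P) + \<Gamma> P (y' h) (z P) + \<Gamma> P (y P) (z' h))) (at P)"
begin

abbreviation "nab \<equiv> christoffel_connection \<Gamma>"

lemmas add_right = linear_add[OF linear]
  and scale_right = linear_cmul[OF linear]
  and diff_right = linear_diff[OF linear]

lemma add_left: "\<Gamma> P (u + v) w = \<Gamma> P u w + \<Gamma> P v w"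
  and scale_left: "\<Gamma> P (r *\<^sub>R u) w = r *\<^sub>R \<Gamma> P u w"
  and diff_left: "\<Gamma> P (u - v) w = \<Gamma> P u w - \<Gamma> P v w"
  using add_right scale_right diff_right by (simp_all add: sym[of P _ w])

lemma nab_tvec:
  "nab (\<lambda>P. tvec (x P)) (\<lambda>P. tvec (y P)) =
    (\<lambda>P. tvec (frechet_derivative y (at P) (x P) + \<Gamma> P (x P) (y P)))"
  by (simp add: christoffel_connection_def)

text \<open>The Leibniz rules come from the product rule, and the torsion vanishes because \<Gamma>
  is symmetric. What remains, compatibility with the metric, is the hypothesis
  \<open>compat\<close>, taken at the direction of the first field.\<close>

lemma levi_civita_nab:
  assumes compat: "\<And>P y y' z z'. (y has_derivative y') (at P) \<Longrightarrow> (z has_derivative z') (at P) \<Longrightarrow>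
      ((\<lambda>Q. G Q (y Q) (z Q)) has_derivative
        (\<lambda>h. G P (y' h + \<Gamma> P h (y P)) (z P) + G P (y P) (z' h + \<Gamma> P h (z P)))) (at P)"
  shows "levi_civita std_atlas (\<lambda>P x y. G P (x std_chart) (y std_chart)) nab"
  unfolding levi_civita_def
proof (intro allI impI)
  fix X Y :: "(real ^ 'n, 'n) vfield"
  assume "smooth_vfield std_atlas X" "smooth_vfield std_atlas Y"
  then obtain x y where X: "X = (\<lambda>P. tvec (x P))" "smooth_on UNIV x"
    and Y: "Y = (\<lambda>P. tvec (y P))" "smooth_on UNIV y"
    by (metis smooth_vfield_stdE)
  have dif: "f differentiable at P" if "smooth_on UNIV f"
    for f :: "real ^ 'n \<Rightarrow> 'b::real_normed_vector" and P
    using smooth_on_imp_differentiable[OF that] by simp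
  note D = has_derivative_frechet[OF dif]
  have linD: "frechet_derivative f (at P) (u + v) = frechet_derivative f (at P) u + frechet_derivative f (at P) v"
    "frechet_derivative f (at P) (r *\<^sub>R u) = r *\<^sub>R frechet_derivative f (at P) u"
    if "smooth_on UNIV f" for f :: "real ^ 'n \<Rightarrow> 'b::real_normed_vector" and P u v r
    using linear_frechet_derivative[OF dif[OF that]] by (simp_all add: linear_add linear_cmul)
  have "smooth_vfield std_atlas (nab X Y)"
    unfolding X Y nab_tvec smooth_vfield_tvec
    by (intro smooth_on_add smooth smooth_on_frechet_derivative_field open_UNIV X Y)
  moreover have "nab (X + Z) Y P = nab X Y P + nab Z Y P" "nab X (Y + Z) P = nab X Y P + nab X Z P"
    if sZ: "smooth_vfield std_atlas Z" for Z P
  proof -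
    obtain z where Z: "Z = (\<lambda>P. tvec (z P))" "smooth_on UNIV z"
      by (rule smooth_vfield_stdE[OF sZ])
    have "frechet_derivative (\<lambda>P. y P + z P) (at P) = 
        (\<lambda>h. frechet_derivative y (at P) h + frechet_derivative z (at P) h)"
      by (intro frechet_derivative_eqI has_derivative_add D Y Z)
    then show "nab (X + Z) Y P = nab X Y P + nab Z Y P" "nab X (Y + Z) P = nab X Y P + nab X Z P"
      by (simp_all add: X Y Z christoffel_connection_def linD[OF Y(2)] add_left add_right tvec_add)
  qed
  moreover have "nab (\<lambda>Q. f Q *\<^sub>R X Q) Y P = f P *\<^sub>R nab X Y P"
    "nab X (\<lambda>Q. f Q *\<^sub>R Y Q) P = dir_deriv std_atlas P (X P) f *\<^sub>R Y P + f P *\<^sub>R nab X Y P"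
    if "smooth_fun std_atlas f" for f P
  proof -
    have f: "smooth_on UNIV f" using that by (simp add: smooth_fun_std)
    have "frechet_derivative (\<lambda>P. f P *\<^sub>R y P) (at P) = 
        (\<lambda>h. f P *\<^sub>R frechet_derivative y (at P) h + frechet_derivative f (at P) h *\<^sub>R y P)"
      by (intro frechet_derivative_eqI has_derivative_scaleR D Y f)
    then show "nab (\<lambda>Q. f Q *\<^sub>R X Q) Y P = f P *\<^sub>R nab X Y P"
      "nab X (\<lambda>Q. f Q *\<^sub>R Y Q) P = dir_deriv std_atlas P (X P) f *\<^sub>R Y P + f P *\<^sub>R nab X Y P"
      by (simp_all add: X Y christoffel_connection_def linD[OF Y(2)] scale_left scale_right
          scaleR_add_right tvec_add tvec_scaleR)
  qed
  moreover have "nab X Y P - nab Y X P = lie_bracket std_atlas X Y P" for P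
    by (simp add: X Y nab_tvec lie_bracket_tvec sym[of P "x P"] flip: tvec_diff)
  moreover have "dir_deriv std_atlas P (X P) (\<lambda>Q. G Q (Y Q std_chart) (Z Q std_chart)) =
      G P (nab X Y P std_chart) (Z P std_chart) + G P (Y P std_chart) (nab X Z P std_chart)"
    if sZ: "smooth_vfield std_atlas Z" for Z P
  proof -
    obtain z where Z: "Z = (\<lambda>P. tvec (z P))" "smooth_on UNIV z"
      by (rule smooth_vfield_stdE[OF sZ])
    show ?thesis
      using frechet_derivative_eqI[OF compat[OF D[OF Y(2)] D[OF Z(2)], of P]]
      by (simp add: X Y Z nab_tvec)
  qed
  ultimately show "smooth_vfield std_atlas (nab X Y) \<and>
        (\<forall>Z. smooth_vfield std_atlas Z \<longrightarrow> (\<forall>P\<in>points std_atlas.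
            nab (X + Z) Y P = nab X Y P + nab Z Y P \<and>
            nab X (Y + Z) P = nab X Y P + nab X Z P)) \<and>
        (\<forall>f. smooth_fun std_atlas f \<longrightarrow> (\<forall>P\<in>points std_atlas.
            nab (\<lambda>Q. f Q *\<^sub>R X Q) Y P = f P *\<^sub>R nab X Y P \<and>
            nab X (\<lambda>Q. f Q *\<^sub>R Y Q) P = dir_deriv std_atlas P (X P) f *\<^sub>R Y P + f P *\<^sub>R nab X Y P)) \<and>
        (\<forall>P\<in>points std_atlas. nab X Y P - nab Y X P = lie_bracket std_atlas X Y P) \<and>
        (\<forall>Z. smooth_vfield std_atlas Z \<longrightarrow> (\<forall>P\<in>points std_atlas.
            dir_deriv std_atlas P (X P) (\<lambda>Q. G Q (Y Q std_chart) (Z Q std_chart)) =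
              G P (nab X Y P std_chart) (Z P std_chart) + G P (Y P std_chart) (nab X Z P std_chart)))"
    by blast
qed

text \<open>The classical coordinate formula. All derivatives of the chosen extensions cancel, so
  only their values at \<open>P\<close> survive.\<close>

lemma curvature_operator_nab:
  "curvature_operator std_atlas nab P (tvec u) (tvec v) (tvec w) =
    tvec (\<Gamma>' P u v w - \<Gamma>' P v u w + \<Gamma> P u (\<Gamma> P v w) - \<Gamma> P v (\<Gamma> P u w))"
proof -
  obtain x where X: "extension std_atlas P (tvec u) = (\<lambda>Q. tvec (x Q))" "smooth_on UNIV x" "x P = u"
    by (rule extension_stdE)
  obtain y where Y: "extension std_atlas P (tvec v) = (\<lambda>Q. tvec (y Q))" "smooth_on UNIV y" "y P = v"
    by (rule extension_stdE)
  obtain z where Z: "extension std_atlas P (tvec w) = (\<lambda>Q. tvec (z Q))" "smooth_on UNIV z" "z P = w"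
    by (rule extension_stdE)
  have dif: "f differentiable at P" if "smooth_on UNIV f" for f :: "real ^ 'n \<Rightarrow> real ^ 'n" and P
    using smooth_on_imp_differentiable[OF that] by simp
  note D = has_derivative_frechet[OF dif]
  let ?D = "\<lambda>f h. frechet_derivative f (at P) h"
  have nn: "?D (\<lambda>Q. frechet_derivative z (at Q) (x Q) + \<Gamma> Q (x Q) (z Q)) h =
      ?D (\<lambda>Q. frechet_derivative z (at Q) (x P)) h + ?D z (?D x h) +
      (\<Gamma>' P h (x P) (z P) + \<Gamma> P (?D x h) (z P) + \<Gamma> P (x P) (?D z h))"
    if x: "smooth_on UNIV x" for x h
    by (rule fun_cong[OF frechet_derivative_eqI[OF has_derivative_add[OF
            has_derivative_frechet_derivative_field[OF open_UNIV UNIV_I Z(2) dif[OF x]]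
            deriv[OF D[OF x] D[OF Z(2)]]]]])
  \<comment> \<open>Symmetry of second derivatives removes the second-order terms in
    \<open>z\<close>; the next fact splits the derivative of \<open>z\<close> along the bracket,
    which cancels the derivatives of \<open>x\<close> and \<open>y\<close>.\<close>
  have c: "?D (\<lambda>Q. frechet_derivative z (at Q) u) v = ?D (\<lambda>Q. frechet_derivative z (at Q) v) u"
    by (rule frechet_derivative_commute[OF open_UNIV UNIV_I Z(2)])
  have d: "?D z (p - q) = ?D z p - ?D z q" for p q
    by (rule linear_diff[OF linear_frechet_derivative[OF dif[OF Z(2)]]])
  show ?thesis
    unfolding curvature_operator_def curvature_of_fields_def X(1) Y(1) Z(1) nab_tvec lie_bracket_tvec
    by (simp add: nn[OF X(2)] nn[OF Y(2)] X(3) Y(3) Z(3) c d diff_left add_right add_left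
        flip: tvec_diff)
qed

end

subsection \<open>The product of two hyperbolic planes and a flat space\<close>

lemma smooth_on_component: "smooth_on UNIV (\<lambda>P :: real ^ 'n::finite. P $ i)"
  by (rule smooth_on_bounded_linear[OF open_UNIV bounded_linear_vec_nth])

text \<open>The indices \<open>a\<close>, \<open>b\<close> span the first hyperbolic plane, their
  images under \<sigma> the second. The sign \<open>s\<close> changes under \<sigma>, so that the
  signed swap of coordinates squares to minus the identity.\<close>

locale hyperbolic_product =
  fixes a b :: "'n::finite" and \<sigma> :: "'n \<Rightarrow> 'n" and s :: "'n \<Rightarrow> real"
  assumes \<sigma>\<sigma> [simp]: "\<sigma> (\<sigma> i) = i" and s\<sigma>: "s (\<sigma> i) = - s i" and ss: "s i * s i = 1"
    and distinct: "a \<noteq> b" "\<sigma> a \<noteq> a" "\<sigma> a \<noteq> b" "\<sigma> b \<noteq> b" and sab: "s b = s a"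
begin

lemma ss' [simp]: "s i * s i = 1" "s i * (s i * r) = r"
  using ss by (simp_all flip: mult.assoc)

lemma distinct' [simp]:
  "a \<noteq> b" "\<sigma> a \<noteq> a" "\<sigma> a \<noteq> b" "\<sigma> b \<noteq> b" "\<sigma> b \<noteq> a" "\<sigma> a \<noteq> \<sigma> b"
  "b \<noteq> a" "a \<noteq> \<sigma> a" "b \<noteq> \<sigma> a" "b \<noteq> \<sigma> b" "a \<noteq> \<sigma> b" "\<sigma> b \<noteq> \<sigma> a"
  using distinct by (metis \<sigma>\<sigma>)+

text \<open>Logarithms of the lengths of the coordinate vectors; the coordinate vectors scaled by
  \<open>exp (- lwt P i)\<close> form an orthonormal frame.\<close>

definition lwt :: "real ^ 'n \<Rightarrow> 'n \<Rightarrow> real"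
  where "lwt P i = (if i = b then P $ a else if i = \<sigma> b then P $ \<sigma> a else 0)"

definition metric :: "real ^ 'n \<Rightarrow> real ^ 'n \<Rightarrow> real ^ 'n \<Rightarrow> real"
  where "metric P u v = (\<Sum>i\<in>UNIV. exp (2 * lwt P i) * u $ i * v $ i)"

text \<open>In the orthonormal frame this is the signed permutation of components by \<sigma>; the
  exponentials convert between frame and coordinate components.\<close>

definition cplx :: "real ^ 'n \<Rightarrow> real ^ 'n \<Rightarrow> real ^ 'n"
  where "cplx P u = (\<chi> i. s i * exp (lwt P (\<sigma> i) - lwt P i) * u $ \<sigma> i)"

text \<open>A rational point of the unit circle replaces cosine and sine. Its angle is not a
  multiple of a quarter turn, and quarter turns would preserve the curvature.\<close>

definition rot :: "real ^ 'n \<Rightarrow> real ^ 'n \<Rightarrow> real ^ 'n"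
  where "rot P u = (3/5) *\<^sub>R u + (4/5) *\<^sub>R cplx P u"

text \<open>For \<open>dx^2 + exp (2x) dy^2\<close> the nonzero Christoffel symbols are
  \<open>- exp (2x)\<close>, with upper index \<open>x\<close> and lower indices \<open>yy\<close>,
  and 1, with upper index \<open>y\<close> and lower indices \<open>xy\<close> or \<open>yx\<close>.
  They are placed on the two planes here.\<close>

definition chr :: "real ^ 'n \<Rightarrow> real ^ 'n \<Rightarrow> real ^ 'n \<Rightarrow> real ^ 'n" where
  "chr P u v = (\<chi> i.
     if i = a then - exp (2 * P $ a) * u $ b * v $ b
     else if i = b then u $ a * v $ b + u $ b * v $ a
     else if i = \<sigma> a then - exp (2 * P $ \<sigma> a) * u $ \<sigma> b * v $ \<sigma> b
     else if i = \<sigma> b then u $ \<sigma> a * v $ \<sigma> b + u $ \<sigma> b * v $ \<sigma> a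
     else 0)"

definition chr' :: "real ^ 'n \<Rightarrow> real ^ 'n \<Rightarrow> real ^ 'n \<Rightarrow> real ^ 'n \<Rightarrow> real ^ 'n" where
  "chr' P h u v = (\<chi> i.
     if i = a then - 2 * h $ a * exp (2 * P $ a) * u $ b * v $ b
     else if i = \<sigma> a then - 2 * h $ \<sigma> a * exp (2 * P $ \<sigma> a) * u $ \<sigma> b * v $ \<sigma> b
     else 0)"

text \<open>On each plane this is \<open>g(x,z) y - g(y,z) x\<close>, the curvature of constant
  sectional curvature -1, with the terms that cancel left out.\<close>

definition curv :: "real ^ 'n \<Rightarrow> real ^ 'n \<Rightarrow> real ^ 'n \<Rightarrow> real ^ 'n \<Rightarrow> real ^ 'n" where
  "curv P x y z = (\<chi> i.
     if i = a then - exp (2 * P $ a) * (x $ a * y $ b - x $ b * y $ a) * z $ b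
     else if i = b then (x $ a * y $ b - x $ b * y $ a) * z $ a
     else if i = \<sigma> a then
       - exp (2 * P $ \<sigma> a) * (x $ \<sigma> a * y $ \<sigma> b - x $ \<sigma> b * y $ \<sigma> a) * z $ \<sigma> b
     else if i = \<sigma> b then (x $ \<sigma> a * y $ \<sigma> b - x $ \<sigma> b * y $ \<sigma> a) * z $ \<sigma> a
     else 0)"

lemma smooth_lwt: "smooth_on UNIV (\<lambda>P. lwt P i)"
  by (cases "i = b"; cases "i = \<sigma> b")
    (simp_all add: lwt_def smooth_on_component smooth_on_const)

lemma has_derivative_lwt: "((\<lambda>P. lwt P i) has_derivative (\<lambda>h. lwt h i)) (at P)"
  by (cases "i = b"; cases "i = \<sigma> b")
    (simp_all add: lwt_def bounded_linear_imp_has_derivative bounded_linear_vec_nth)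

lemma lwt_simps [simp]:
  "lwt P a = 0" "lwt P (\<sigma> a) = 0" "lwt P b = P $ a" "lwt P (\<sigma> b) = P $ \<sigma> a"
  by (simp_all add: lwt_def)

lemma curv_simps:
  "curv P x y z $ a = - exp (2 * P $ a) * (x $ a * y $ b - x $ b * y $ a) * z $ b"
  "curv P x y z $ b = (x $ a * y $ b - x $ b * y $ a) * z $ a"
  "curv P x y z $ \<sigma> a = - exp (2 * P $ \<sigma> a) * (x $ \<sigma> a * y $ \<sigma> b - x $ \<sigma> b * y $ \<sigma> a) * z $ \<sigma> b"
  "curv P x y z $ \<sigma> b = (x $ \<sigma> a * y $ \<sigma> b - x $ \<sigma> b * y $ \<sigma> a) * z $ \<sigma> a"
  "i \<notin> {a, b, \<sigma> a, \<sigma> b} \<Longrightarrow> curv P x y z $ i = 0"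
  by (simp_all add: curv_def)

lemma chr_simps:
  "chr P u v $ a = - exp (2 * P $ a) * u $ b * v $ b"
  "chr P u v $ b = u $ a * v $ b + u $ b * v $ a"
  "chr P u v $ \<sigma> a = - exp (2 * P $ \<sigma> a) * u $ \<sigma> b * v $ \<sigma> b"
  "chr P u v $ \<sigma> b = u $ \<sigma> a * v $ \<sigma> b + u $ \<sigma> b * v $ \<sigma> a"
  "i \<notin> {a, b, \<sigma> a, \<sigma> b} \<Longrightarrow> chr P u v $ i = 0"
  by (simp_all add: chr_def)

lemma chr'_simps:
  "chr' P h u v $ a = - 2 * h $ a * exp (2 * P $ a) * u $ b * v $ b"
  "chr' P h u v $ b = 0"
  "chr' P h u v $ \<sigma> a = - 2 * h $ \<sigma> a * exp (2 * P $ \<sigma> a) * u $ \<sigma> b * v $ \<sigma> b"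
  "chr' P h u v $ \<sigma> b = 0"
  "i \<notin> {a, b, \<sigma> a, \<sigma> b} \<Longrightarrow> chr' P h u v $ i = 0"
  by (simp_all add: chr'_def)

lemma vec_eqI_four:
  fixes u v :: "real ^ 'n"
  assumes "u $ a = v $ a" "u $ b = v $ b" "u $ \<sigma> a = v $ \<sigma> a" "u $ \<sigma> b = v $ \<sigma> b"
    "\<And>i. i \<notin> {a, b, \<sigma> a, \<sigma> b} \<Longrightarrow> u $ i = v $ i"
  shows "u = v"
  using assms by (metis insert_iff singletonD vec_eq_iff)

lemma sum_four:
  fixes f :: "'n \<Rightarrow> real"
  assumes "\<And>i. i \<notin> {a, b, \<sigma> a, \<sigma> b} \<Longrightarrow> f i = 0"
  shows "(\<Sum>i\<in>UNIV. f i) = f a + f b + f (\<sigma> a) + f (\<sigma> b)"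
proof -
  have "(\<Sum>i\<in>UNIV. f i) = (\<Sum>i\<in>{a, b, \<sigma> a, \<sigma> b}. f i)"
    using assms by (intro sum.mono_neutral_right) auto
  then show ?thesis by simp
qed

text \<open>The factor \<open>exp (- 0)\<close> is 1, since the coordinate vectors at
  \<open>a\<close> and \<open>\<sigma> a\<close> both have length 1.\<close>

lemma cplx_simps:
  "cplx P u $ a = s a * exp (- 0) * u $ \<sigma> a"
  "cplx P u $ b = s a * exp (P $ \<sigma> a - P $ a) * u $ \<sigma> b"
  "cplx P u $ \<sigma> a = - s a * u $ a"
  "cplx P u $ \<sigma> b = - s a * exp (P $ a - P $ \<sigma> a) * u $ b"
  by (simp_all add: cplx_def s\<sigma> sab)

section \<open>Algebra of the metric, the almost complex structure and the rotation\<close>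

lemma linear_metric: "linear (metric P u)"
  by (rule linearI)
    (simp_all add: metric_def algebra_simps sum.distrib sum_distrib_left)

lemma metric_sym: "metric P u v = metric P v u"
  by (simp add: metric_def algebra_simps)

lemma metric_pos: "u \<noteq> 0 \<Longrightarrow> metric P u u > 0"
proof -
  assume "u \<noteq> 0"
  then obtain j where "u $ j \<noteq> 0" by (auto simp: vec_eq_iff)
  then show ?thesis
    unfolding metric_def
    by (intro sum_pos2[of _ j]) (auto simp: mult.assoc zero_less_mult_iff not_less linorder_neq_iff)
qed

lemma smooth_metric: "smooth_on UNIV (\<lambda>P. metric P u v)"
  unfolding metric_def
  by (intro smooth_on_sum smooth_on_mult smooth_on_exp smooth_on_const smooth_lwt open_UNIV)

lemma linear_cplx: "linear (cplx P)"
  by (rule linearI) (simp_all add: cplx_def vec_eq_iff algebra_simps)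

lemma smooth_cplx: "smooth_on UNIV (\<lambda>P. cplx P u)"
  unfolding cplx_def
  by (intro smooth_on_vec_lambda smooth_on_mult smooth_on_exp smooth_on_diff smooth_on_const
      smooth_lwt open_UNIV)

lemma cplx_cplx: "cplx P (cplx P u) = - u"
  by (simp add: cplx_def vec_eq_iff s\<sigma> exp_diff)

text \<open>The exponentials in \<open>cplx\<close> turn the weight at \<open>i\<close> into the
  weight at \<open>\<sigma> i\<close> and the signs square to 1; reindexing the sum by the
  involution \<sigma> then gives the metric back.\<close>

lemma metric_cplx: "metric P (cplx P u) (cplx P v) = metric P u v"
proof -
  have "metric P (cplx P u) (cplx P v) =
      (\<Sum>i\<in>UNIV. exp (2 * lwt P (\<sigma> i)) * u $ \<sigma> i * v $ \<sigma> i)"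
    unfolding metric_def
  proof (rule sum.cong)
    fix i
    have "exp (2 * lwt P i) * (exp (lwt P (\<sigma> i) - lwt P i) * exp (lwt P (\<sigma> i) - lwt P i))
        = exp (2 * lwt P (\<sigma> i))"
      by (simp flip: exp_add)
    moreover have "exp (2 * lwt P i) * cplx P u $ i * cplx P v $ i =
        (exp (2 * lwt P i) * (exp (lwt P (\<sigma> i) - lwt P i) * exp (lwt P (\<sigma> i) - lwt P i))) *
        (s i * s i) * (u $ \<sigma> i * v $ \<sigma> i)"
      unfolding cplx_def vec_lambda_beta by (simp only: ac_simps)
    ultimately show "exp (2 * lwt P i) * cplx P u $ i * cplx P v $ i =
        exp (2 * lwt P (\<sigma> i)) * u $ \<sigma> i * v $ \<sigma> i"
      by simp
  qed simp
  also have "\<dots> = metric P u v"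
    unfolding metric_def by (rule sum.reindex_bij_witness[of _ \<sigma> \<sigma>]) auto
  finally show ?thesis .
qed

lemma metric_cplx_left: "metric P (cplx P u) v = - metric P u (cplx P v)"
proof -
  have "metric P (cplx P u) v = metric P (cplx P (cplx P u)) (cplx P v)"
    by (simp add: metric_cplx)
  then show ?thesis
    by (simp add: cplx_cplx linear_neg[OF linear_metric] metric_sym[of P "- u"] metric_sym[of P u])
qed

lemma linear_rot: "linear (rot P)"
  by (rule linearI)
    (simp_all add: rot_def linear_add[OF linear_cplx] linear_cmul[OF linear_cplx] algebra_simps)

lemma smooth_rot: "smooth_on UNIV (\<lambda>P. rot P u)"
  unfolding rot_def
  by (intro smooth_on_add smooth_on_scaleR smooth_on_const smooth_cplx open_UNIV)

lemma rot_cplx: "rot P (cplx P u) = cplx P (rot P u)"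
  by (simp add: rot_def linear_add[OF linear_cplx] linear_cmul[OF linear_cplx])

text \<open>The mixed terms cancel because \<open>cplx\<close> is skew-adjoint, and
  \<open>9/25 + 16/25 = 1\<close>.\<close>

lemma metric_rot: "metric P (rot P u) (rot P v) = metric P u v"
proof -
  note r = linear_add[OF linear_metric] linear_cmul[OF linear_metric]
  have l: "metric P (x + y) z = metric P x z + metric P y z" "metric P (c *\<^sub>R x) z = c * metric P x z" for x y z c
    using r by (simp_all add: metric_sym[of P _ z])
  show ?thesis
    by (simp add: rot_def l r metric_cplx_left cplx_cplx linear_neg[OF linear_metric] field_simps)
qed

section \<open>The Levi-Civita connection of the product metric\<close>

lemma has_derivative_component:
  "(f has_derivative f') F \<Longrightarrow> ((\<lambda>x. f x $ i) has_derivative (\<lambda>h. f' h $ i)) F"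
  by (rule bounded_linear.has_derivative[OF bounded_linear_vec_nth])

sublocale christoffel chr chr'
proof (rule christoffel.intro)
  fix P u :: "real ^ 'n"
  show "linear (chr P u)"
    by (rule linearI; rule vec_eqI_four) (simp_all add: chr_simps algebra_simps)
next
  fix P u v :: "real ^ 'n"
  show "chr P u v = chr P v u"
    by (rule vec_eqI_four) (simp_all add: chr_simps algebra_simps)
next
  fix y z :: "real ^ 'n \<Rightarrow> real ^ 'n"
  assume yz: "smooth_on UNIV y" "smooth_on UNIV z"
  have "smooth_on UNIV (\<lambda>Q. chr Q (y Q) (z Q) $ i)" for i
  proof (cases "i \<in> {a, b, \<sigma> a, \<sigma> b}")
    case True
    then show ?thesis
      by (elim insertE emptyE) (simp_all only: chr_simps, (intro smooth_on_add smooth_on_mult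
          smooth_on_minus smooth_on_exp smooth_on_const smooth_on_component
          smooth_on_vec_nth yz open_UNIV)+)
  qed (simp add: chr_simps smooth_on_const)
  from smooth_on_vec_lambda[OF open_UNIV this, of "\<lambda>i. i"] show "smooth_on UNIV (\<lambda>Q. chr Q (y Q) (z Q))"
    by simp
next
  fix y z y' z' :: "real ^ 'n \<Rightarrow> real ^ 'n" and P
  assume yz: "(y has_derivative y') (at P)" "(z has_derivative z') (at P)"
  note D = yz[THEN has_derivative_component] has_derivative_component[OF has_derivative_ident]
  let ?D = "\<lambda>h. chr' P h (y P) (z P) + chr P (y' h) (z P) + chr P (y P) (z' h)"
  \<comment> \<open>The nonzero components of \<open>chr\<close> have two shapes, treated for the
    pairs \<open>(a, b)\<close> and \<open>(\<sigma> a, \<sigma> b)\<close> at once. Only the first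
    shape depends explicitly on the base point.\<close>
  have 1: "((\<lambda>Q. - exp (2 * Q $ k) * y Q $ l * z Q $ l) has_derivative
      (\<lambda>h. - 2 * h $ k * exp (2 * P $ k) * y P $ l * z P $ l
        + - exp (2 * P $ k) * y' h $ l * z P $ l + - exp (2 * P $ k) * y P $ l * z' h $ l)) (at P)" for k l
    by (rule derivative_eq_intros D refl ext)+ (simp add: algebra_simps)
  have 2: "((\<lambda>Q. y Q $ k * z Q $ l + y Q $ l * z Q $ k) has_derivative
      (\<lambda>h. (y' h $ k * z P $ l + y' h $ l * z P $ k) + (y P $ k * z' h $ l + y P $ l * z' h $ k))) (at P)" for k l
    by (rule derivative_eq_intros D refl ext)+ (simp add: algebra_simps)
  have "((\<lambda>Q. chr Q (y Q) (z Q) $ i) has_derivative (\<lambda>h. ?D h $ i)) (at P)" for i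
  proof (cases "i \<in> {a, b, \<sigma> a, \<sigma> b}")
    case True
    then show ?thesis
      by (elim insertE emptyE) (simp_all only: chr_simps chr'_simps vector_add_component add_0 1 2)
  qed (simp add: chr_simps chr'_simps)
  then show "((\<lambda>Q. chr Q (y Q) (z Q)) has_derivative ?D) (at P)"
    by (subst has_derivative_componentwise_within) (auto simp: Basis_vec_def inner_axis)
qed

lemma metric_compatible:
  assumes "(y has_derivative y') (at P)" "(z has_derivative z') (at P)"
  shows "((\<lambda>Q. metric Q (y Q) (z Q)) has_derivative
    (\<lambda>h. metric P (y' h + chr P h (y P)) (z P) + metric P (y P) (z' h + chr P h (z P)))) (at P)"
proof -
  note D = assms[THEN has_derivative_component]
  have "((\<lambda>Q. metric Q (y Q) (z Q)) has_derivative
    (\<lambda>h. \<Sum>i\<in>UNIV. exp (2 * lwt P i) * (2 * lwt h i * y P $ i * z P $ i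
      + y' h $ i * z P $ i + y P $ i * z' h $ i))) (at P)"
    unfolding metric_def
    by (auto intro!: derivative_eq_intros has_derivative_lwt D simp: algebra_simps)
  moreover have "metric P (y' h + chr P h (y P)) (z P) + metric P (y P) (z' h + chr P h (z P)) =
    (\<Sum>i\<in>UNIV. exp (2 * lwt P i) * (2 * lwt h i * y P $ i * z P $ i
      + y' h $ i * z P $ i + y P $ i * z' h $ i))" for h
  proof -
    \<comment> \<open>The single summands do not vanish: the one at \<open>a\<close> cancels the one
      at \<open>b\<close>, and likewise in the second plane.\<close>
    have "(\<Sum>i\<in>UNIV. exp (2 * lwt P i) *
        (chr P h (y P) $ i * z P $ i + y P $ i * chr P h (z P) $ i - 2 * lwt h i * y P $ i * z P $ i)) = 0"
      by (subst sum_four) (simp_all add: chr_simps lwt_def algebra_simps)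
    then show ?thesis
      by (simp add: metric_def algebra_simps sum.distrib sum_subtractf)
  qed
  ultimately show ?thesis by simp
qed

section \<open>Curvature under the almost complex structure and the rotation\<close>

lemma curvature_operator_hyperbolic:
  "curvature_operator std_atlas nab P (tvec x) (tvec y) (tvec z) = tvec (curv P x y z)"
  unfolding curvature_operator_nab tvec_eq_iff
  by (rule vec_eqI_four) (simp_all add: chr_simps chr'_simps curv_simps algebra_simps)

text \<open>\<open>cplx P\<close> is a linear isometry that exchanges two planes of the same
  constant curvature, and \<sigma> preserves the remaining indices, where the curvature
  vanishes.\<close>

lemma curv_cplx: "curv P (cplx P x) (cplx P y) (cplx P z) = cplx P (curv P x y z)"
proof (rule vec_eqI_four)
  fix i assume "i \<notin> {a, b, \<sigma> a, \<sigma> b}"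
  moreover from this have "\<sigma> i \<notin> {a, b, \<sigma> a, \<sigma> b}" by (metis \<sigma>\<sigma> insert_iff singletonD)
  ultimately show "curv P (cplx P x) (cplx P y) (cplx P z) $ i = cplx P (curv P x y z) $ i"
    by (simp add: curv_simps cplx_def)
qed (simp_all only: curv_simps cplx_simps exp_double, simp_all add: exp_diff field_simps power2_eq_square)

lemma curv_linear:
  "curv P (x + x') y z = curv P x y z + curv P x' y z" "curv P (r *\<^sub>R x) y z = r *\<^sub>R curv P x y z"
  "curv P x (y + y') z = curv P x y z + curv P x y' z" "curv P x (r *\<^sub>R y) z = r *\<^sub>R curv P x y z"
  "curv P x y (z + z') = curv P x y z + curv P x y z'" "curv P x y (r *\<^sub>R z) = r *\<^sub>R curv P x y z"
  by (rule vec_eqI_four; simp add: curv_simps algebra_simps)+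

lemma curv_minus:
  "curv P (- x) y z = - curv P x y z" "curv P x (- y) z = - curv P x y z" "curv P x y (- z) = - curv P x y z"
  using curv_linear(2)[of P "-1"] curv_linear(4)[of P _ "-1"] curv_linear(6)[of P _ _ "-1"] by simp_all

lemma curv_skew: "curv P y x z = - curv P x y z"
  by (rule vec_eqI_four) (simp_all add: curv_simps algebra_simps)

text \<open>By \<open>curv_cplx\<close>, applying \<open>cplx\<close> exchanges the two summands
  while replacing \<open>v\<close> by its image, because the two signs from \<open>cplx_cplx\<close>
  cancel. The sum therefore commutes with \<open>cplx\<close>, hence with
  \<open>rot\<close>.\<close>

lemma rot_jacobi:
  "rot P (curv P v u u + curv P v (cplx P u) (cplx P u)) =
    curv P (rot P v) u u + curv P (rot P v) (cplx P u) (cplx P u)"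
proof -
  have "cplx P (curv P v u u) = curv P (cplx P v) (cplx P u) (cplx P u)"
    "cplx P (curv P v (cplx P u) (cplx P u)) = curv P (cplx P v) u u"
    by (simp_all add: cplx_cplx curv_minus flip: curv_cplx)
  then show ?thesis
    by (simp add: rot_def curv_linear linear_add[OF linear_cplx] algebra_simps)
qed

text \<open>Applying \<open>cplx\<close> to both \<open>u\<close> and \<open>cplx P u\<close> swaps
  them up to a sign, which skew-symmetry absorbs.\<close>

lemma rot_curv: "rot P (curv P u (cplx P u) v) = curv P u (cplx P u) (rot P v)"
proof -
  have "cplx P (curv P u (cplx P u) v) = curv P u (cplx P u) (cplx P v)"
    by (simp add: cplx_cplx curv_minus curv_skew[of P "cplx P u" u] flip: curv_cplx)
  then show ?thesis
    by (simp add: rot_def curv_linear)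
qed

text \<open>Both vectors are tangent to the first plane, but after rotation both planes contribute,
  with factors \<open>(3/5)^4\<close> and \<open>(4/5)^4\<close>. Their sum is 337/625 rather than
  1.\<close>

lemma not_rot_invariant:
  defines "p \<equiv> axis a 1" and "q \<equiv> axis b 1"
  shows "metric P (curv P (rot P p) (rot P q) (rot P q)) (rot P p) \<noteq> metric P (curv P p q q) p"
proof -
  have 1: "metric P (curv P p q q) p = - exp (2 * P $ a)"
    unfolding metric_def
    by (subst sum_four) (simp_all add: curv_simps p_def q_def axis_def)
  have r: "rot P p $ a = 3/5" "rot P p $ b = 0" "rot P p $ \<sigma> a = - 4/5 * s a" "rot P p $ \<sigma> b = 0"
    "rot P q $ a = 0" "rot P q $ b = 3/5" "rot P q $ \<sigma> a = 0"
    "rot P q $ \<sigma> b = - 4/5 * s a * exp (P $ a - P $ \<sigma> a)"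
    by (simp_all add: rot_def cplx_simps p_def q_def axis_def)
  \<comment> \<open>The square of the exponential in the \<open>\<sigma> b\<close> component of
    \<open>rot P q\<close> turns the weight of the second plane into that of the first.\<close>
  have "metric P (curv P (rot P p) (rot P q) (rot P q)) (rot P p) =
     - exp (2 * P $ a) * ((3/5)^4 + (4/5)^4)"
    unfolding metric_def
    by (subst sum_four) (simp_all add: curv_simps r, simp_all only: exp_double,
      simp_all add: exp_diff field_simps power2_eq_square)
  then show ?thesis
    unfolding 1 by (simp add: power4_eq_xxxx)
qed

end


section \<open>Transfer to fields on tangent vectors\<close>

context hyperbolic_product
begin

definition metric_field :: "(real ^ 'n, 'n) bfield"
  where "metric_field P x y = metric P (x std_chart) (y std_chart)"

definition cplx_field :: "(real ^ 'n, 'n) efield"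
  where "cplx_field P x = tvec (cplx P (x std_chart))"

definition rot_field :: "(real ^ 'n, 'n) efield"
  where "rot_field P x = tvec (rot P (x std_chart))"

lemma almost_hermitian: "almost_hermitian_manifold euclidean std_atlas metric_field cplx_field"
proof -
  have "riemannian_metric std_atlas metric_field"
    unfolding metric_field_def riemannian_metric_std
    using linear_metric metric_sym metric_pos smooth_metric by blast
  moreover have "smooth_endomorphism_field std_atlas cplx_field"
    unfolding cplx_field_def smooth_endomorphism_field_tvec
    using linear_cplx smooth_cplx by blast
  ultimately show ?thesis
    by (auto simp: almost_hermitian_manifold_def almost_complex_structure_def smooth_manifold_std
        metric_field_def cplx_field_def metric_cplx cplx_cplx tvec_minus elim!: tangent_space_stdE)
qed

lemma unitary_section: "smooth_unitary_section std_atlas metric_field cplx_field rot_field"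
proof -
  have "smooth_endomorphism_field std_atlas rot_field"
    unfolding rot_field_def smooth_endomorphism_field_tvec
    using linear_rot smooth_rot by blast
  then show ?thesis
    by (simp add: smooth_unitary_section_def metric_field_def cplx_field_def rot_field_def
        rot_cplx metric_rot)
qed

text \<open>A complex line is a subspace stable under \<open>cplx_field\<close>, hence under its
  combinations with the identity. Consequently \<open>unit_vector\<close> makes the same choice for
  \<pi> and for its image.\<close>

lemma rot_field_image:
  assumes "\<pi> \<in> complex_lines std_atlas cplx_field P"
  shows "rot_field P ` \<pi> = \<pi>"
proof -
  have \<pi>: "subspace \<pi>" "cplx_field P ` \<pi> = \<pi>" "\<pi> \<subseteq> range tvec"
    using assms by (auto simp: complex_lines_def tangent_space_std)
  have rot: "rot_field P x = (3/5) *\<^sub>R x + (4/5) *\<^sub>R cplx_field P x" if "x \<in> \<pi>" for x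
    using \<pi>(3) that by (auto simp: rot_field_def rot_def cplx_field_def tvec_add tvec_scaleR)
  have J: "cplx_field P x \<in> \<pi>" if "x \<in> \<pi>" for x
    using \<pi>(2) that by blast
  have "rot_field P x \<in> \<pi>" if "x \<in> \<pi>" for x
    unfolding rot[OF that] using \<pi>(1) that J[OF that] by (intro subspace_add subspace_scale)
  moreover have "x \<in> rot_field P ` \<pi>" if x: "x \<in> \<pi>" for x
  proof
    \<comment> \<open>The inverse rotation, by the conjugate \<open>3/5 - 4/5 J\<close>.\<close>
    let ?y = "(3/5) *\<^sub>R x - (4/5) *\<^sub>R cplx_field P x"
    show y: "?y \<in> \<pi>"
      using \<pi>(1) x J[OF x] by (intro subspace_diff subspace_scale)
    obtain u where u: "x = tvec u" using \<pi>(3) x by blast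
    have "cplx_field P ?y = (3/5) *\<^sub>R cplx_field P x + (4/5) *\<^sub>R x"
      by (simp add: u cplx_field_def linear_diff[OF linear_cplx] linear_cmul[OF linear_cplx]
          cplx_cplx flip: tvec_add tvec_scaleR)
    then show "x = rot_field P ?y"
      unfolding rot[OF y] by (simp add: algebra_simps flip: scaleR_left_distrib)
  qed
  ultimately show ?thesis by blast
qed

text \<open>Dimension 2 provides a nonzero vector, and normalising it shows that the choice in
  \<open>unit_vector\<close> can be met.\<close>

lemma unit_vector_in_line:
  assumes "\<pi> \<in> complex_lines std_atlas cplx_field P"
  shows "unit_vector metric_field P \<pi> \<in> \<pi>"
proof -
  have \<pi>: "subspace \<pi>" "dim \<pi> = 2" "\<pi> \<subseteq> range tvec"
    using assms by (auto simp: complex_lines_def tangent_space_std)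
  have "\<not> \<pi> \<subseteq> {0}"
  proof
    assume "\<pi> \<subseteq> {0}"
    then have "span {} = span \<pi>"
      using subspace_0[OF \<pi>(1)] span_insert_0[of "{}"] by (metis subset_singletonD empty_iff)
    from dim_eq_card[OF this] show False
      using \<pi>(2) by (simp add: independent_empty)
  qed
  then obtain x where x: "x \<in> \<pi>" "x \<noteq> 0" by blast
  then obtain u where "x = tvec u"
    using \<pi>(3) by blast
  then have u: "tvec u \<in> \<pi>" "u \<noteq> 0"
    using x by (auto simp: tvec_0)
  define r where "r = 1 / sqrt (metric P u u)"
  have "metric_field P (tvec (r *\<^sub>R u)) (tvec (r *\<^sub>R u)) = r * r * metric P u u"
    by (simp add: metric_field_def linear_cmul[OF linear_metric] metric_sym[of P "r *\<^sub>R u"])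
  also have "\<dots> = 1"
    using metric_pos[OF u(2), of P] by (simp add: r_def)
  finally have "tvec (r *\<^sub>R u) \<in> \<pi> \<and> metric_field P (tvec (r *\<^sub>R u)) (tvec (r *\<^sub>R u)) = 1"
    using subspace_scale[OF \<pi>(1) u(1)] by (simp add: tvec_scaleR)
  then show ?thesis
    unfolding unit_vector_def
    by (rule someI2[of "\<lambda>x. x \<in> \<pi> \<and> metric_field P x x = 1" _ "\<lambda>x. x \<in> \<pi>"]) simp
qed

lemma rot_field_properties:
  "\<forall>P\<in>topspace euclidean. let V = tangent_space std_atlas P; \<theta> = rot_field P in
       (\<forall>\<pi>\<in>complex_lines std_atlas cplx_field P. \<forall>y\<in>V.
          \<theta> (complex_jacobi_operator std_atlas metric_field cplx_field nab P \<pi> y) =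
          complex_jacobi_operator std_atlas metric_field cplx_field nab P (\<theta> ` \<pi>) (\<theta> y)) \<and>
       (\<forall>\<pi>\<in>complex_lines std_atlas cplx_field P. \<forall>y\<in>V.
          \<theta> (complex_curvature_operator std_atlas metric_field cplx_field nab P \<pi> y) =
          complex_curvature_operator std_atlas metric_field cplx_field nab P (\<theta> ` \<pi>) (\<theta> y)) \<and>
       \<not> (\<forall>x\<in>V. \<forall>y\<in>V. \<forall>z\<in>V. \<forall>w\<in>V.
            pullback4 \<theta> (curvature_tensor std_atlas metric_field nab P) x y z w =
            curvature_tensor std_atlas metric_field nab P x y z w)"
proof (intro ballI, unfold Let_def, intro conjI ballI)
  fix P \<pi> y
  assume \<pi>: "\<pi> \<in> complex_lines std_atlas cplx_field P" and y: "y \<in> tangent_space std_atlas P"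
  obtain v where v: "y = tvec v"
    using y by (rule tangent_space_stdE)
  obtain u where u: "unit_vector metric_field P \<pi> = tvec u"
    using unit_vector_in_line[OF \<pi>] \<pi> by (auto simp: complex_lines_def tangent_space_std)
  \<comment> \<open>As the line is its own image, both sides involve the same vector
    \<open>u\<close>, and the claims become \<open>rot_jacobi\<close> and
    \<open>rot_curv\<close>.\<close>
  from u v rot_field_image[OF \<pi>] show
    "rot_field P (complex_jacobi_operator std_atlas metric_field cplx_field nab P \<pi> y) =
     complex_jacobi_operator std_atlas metric_field cplx_field nab P (rot_field P ` \<pi>) (rot_field P y)"
    "rot_field P (complex_curvature_operator std_atlas metric_field cplx_field nab P \<pi> y) =
     complex_curvature_operator std_atlas metric_field cplx_field nab P (rot_field P ` \<pi>) (rot_field P y)"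
    by (simp_all add: complex_jacobi_operator_def complex_curvature_operator_def jacobi_operator_def
        cplx_field_def rot_field_def curvature_operator_hyperbolic rot_jacobi rot_curv flip: tvec_add)
next
  fix P :: "real ^ 'n"
  let ?p = "tvec (axis a 1)" and ?q = "tvec (axis b 1)"
  have "pullback4 (rot_field P) (curvature_tensor std_atlas metric_field nab P) ?p ?q ?q ?p \<noteq>
      curvature_tensor std_atlas metric_field nab P ?p ?q ?q ?p"
    using not_rot_invariant[of P]
    by (simp add: pullback4_def curvature_tensor_def curvature_operator_hyperbolic metric_field_def rot_field_def)
  then show "\<not> (\<forall>x\<in>tangent_space std_atlas P. \<forall>y\<in>tangent_space std_atlas P.
      \<forall>z\<in>tangent_space std_atlas P. \<forall>w\<in>tangent_space std_atlas P.
        pullback4 (rot_field P) (curvature_tensor std_atlas metric_field nab P) x y z w =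
        curvature_tensor std_atlas metric_field nab P x y z w)"
    by (meson tvec_in_tangent_space)
qed

end

section \<open>Choice of the indices and conclusion\<close>

text \<open>The indices are numbered from \<open>0\<close> and \<open>\<sigma>\<close> swaps \<open>2k\<close> with \<open>2k+1\<close>, so that
  \<open>a, \<sigma> a, b, \<sigma> b\<close> are \<open>0, 1, 2, 3\<close>.\<close>

lemma hyperbolic_product_exists:
  assumes "0 < CARD('n::finite)" "CARD('n) mod 4 = 0"
  shows "\<exists>(a :: 'n) b \<sigma> s. hyperbolic_product a b \<sigma> s"
proof -
  obtain f :: "'n \<Rightarrow> nat" where f: "bij_betw f UNIV {0..<CARD('n)}"
    using ex_bij_betw_finite_nat[of "UNIV :: 'n set"] by auto
  define g where "g = inv f"
  define t where "t k = (if even k then k + 1 else k - 1)" for k :: nat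
  have ran: "f i < CARD('n)" for i
    using f by (auto simp: bij_betw_def)
  have gf: "g (f i) = i" for i
    using f by (simp add: g_def bij_betw_def)
  have fg: "f (g k) = k" if "k < CARD('n)" for k
    using f that by (simp add: g_def bij_betw_def f_inv_into_f)
  \<comment> \<open>The cardinality is even, so the largest index is odd and is sent down; hence
    \<open>t\<close> stays in range.\<close>
  have t: "t k < CARD('n)" if "k < CARD('n)" for k
    using assms(2) that unfolding t_def by presburger
  have tt: "t (t k) = k" and ev: "even (t k) \<longleftrightarrow> odd k" for k
    by (auto simp: t_def)
  have c4: "CARD('n) \<ge> 4"
    using assms by presburger
  have f4: "f (g k) = k" if "k < 4" for k
    using c4 that by (intro fg) auto
  \<comment> \<open>The involution is \<open>t\<close> carried over to the index type. The sign is
    the parity, which \<open>t\<close> reverses and which agrees at 0 and 2.\<close>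
  have "hyperbolic_product (g 0) (g 2) (\<lambda>i. g (t (f i))) (\<lambda>i. if even (f i) then 1 else - 1)"
  proof
    have ne: "g j \<noteq> g k" if "j \<noteq> k" "j < 4" "k < 4" for j k
      using that f4 by metis
    show "g 0 \<noteq> g 2" "g (t (f (g 0))) \<noteq> g 0" "g (t (f (g 0))) \<noteq> g 2" "g (t (f (g 2))) \<noteq> g 2"
      using ne[of 0 2] ne[of 1 0] ne[of 1 2] ne[of 3 2] by (simp_all add: f4 t_def)
  qed (simp_all add: fg t ran tt gf ev f4)
  then show ?thesis by blast
qed

theorem theorem1p6:
  fixes m :: nat
  assumes "0 < m" and "m mod 4 = 0" and "CARD('n::finite) = m"
  shows "\<exists>(T :: (real ^ 'n) topology) (A :: (real ^ 'n, 'n) atlas) g J nabla \<Theta>.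
    almost_hermitian_manifold T A g J \<and> topspace T \<noteq> {} \<and>
    levi_civita A g nabla \<and>
    smooth_unitary_section A g J \<Theta> \<and>
    (\<forall>P\<in>topspace T. let V = tangent_space A P; \<theta> = \<Theta> P in
       (\<forall>\<pi>\<in>complex_lines A J P. \<forall>y\<in>V.
          \<theta> (complex_jacobi_operator A g J nabla P \<pi> y) =
          complex_jacobi_operator A g J nabla P (\<theta> ` \<pi>) (\<theta> y)) \<and>
       (\<forall>\<pi>\<in>complex_lines A J P. \<forall>y\<in>V.
          \<theta> (complex_curvature_operator A g J nabla P \<pi> y) =
          complex_curvature_operator A g J nabla P (\<theta> ` \<pi>) (\<theta> y)) \<and>
       \<not> (\<forall>x\<in>V. \<forall>y\<in>V. \<forall>z\<in>V. \<forall>w\<in>V.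
            pullback4 \<theta> (curvature_tensor A g nabla P) x y z w = curvature_tensor A g nabla P x y z w))"
proof -
  obtain a b :: 'n and \<sigma> s where "hyperbolic_product a b \<sigma> s"
    using hyperbolic_product_exists[where 'n = 'n] assms by auto
  then interpret hyperbolic_product a b \<sigma> s .
  have "levi_civita std_atlas metric_field nab"
    unfolding metric_field_def by (rule levi_civita_nab[OF metric_compatible])
  with almost_hermitian unitary_section rot_field_properties topspace_euclidean UNIV_not_empty
  show ?thesis by metis
qed

end
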